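(* Let $G = K \rtimes_\varphi \langle t\rangle$ be a finitely generated group with exponential growth, where $K$ is abelian, $\langle t\rangle$ is infinite cyclic and $\varphi\in\mathrm{Aut}(K)$. Let $R$ be a finite symmetric subset of $K$ such that $S=\{(r,1),(0,t^{\pm1}) : r\in R\}$ generates $G$. Then $$\frac{c(S'(r))}{|S(r)|}=O\!\left(\frac{\log r}{r}\right).$$
   Context: $K$ is written additively; elements of $G$ are pairs $(k,t^m)$ with $(k,t^m)(k',t^{m'})=(k+\varphi^m(k'),t^{m+m'})$. $|g|$ denotes the word length of $g$ with respect to $S$; $S(r)=\{g\in G: |g|=r\}$ is the sphere of radius $r$. An element $g$ is a minimal length conjugacy representative if $|g|=\min\{|h| : h \text{ conjugate to } g\}$; $S'(r)\subseteq S(r)$ is the set of minimal length conjugacy representatives in $S(r)$. For $A\subseteq G$, $c(A)$ is the number of distinct conjugacy classes of $G$ meeting $A$. *)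

theory Defs
  imports Main "HOL-Library.Landau_Symbols"
begin

definition phi_pow :: "('k \<Rightarrow> 'k) \<Rightarrow> int \<Rightarrow> 'k \<Rightarrow> 'k" where
  "phi_pow phi m = (if 0 \<le> m then phi ^^ nat m else (inv phi) ^^ nat (- m))"

text \<open>Elements of G = K semidirect <t> are pairs (k, m) standing for (k, t^m).\<close>
definition sd_mult :: "('k::ab_group_add \<Rightarrow> 'k) \<Rightarrow> 'k \<times> int \<Rightarrow> 'k \<times> int \<Rightarrow> 'k \<times> int" where
  "sd_mult phi x y = (fst x + phi_pow phi (snd x) (fst y), snd x + snd y)"

fun sd_prod :: "('k::ab_group_add \<Rightarrow> 'k) \<Rightarrow> ('k \<times> int) list \<Rightarrow> 'k \<times> int" where
  "sd_prod phi [] = (0, 0)"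
| "sd_prod phi (x # xs) = sd_mult phi x (sd_prod phi xs)"

definition gen_set :: "'k::ab_group_add set \<Rightarrow> ('k \<times> int) set" where
  "gen_set R = {(r, 0) | r. r \<in> R} \<union> {(0, 1), (0, -1)}"

definition word_len :: "('k::ab_group_add \<Rightarrow> 'k) \<Rightarrow> ('k \<times> int) set \<Rightarrow> 'k \<times> int \<Rightarrow> nat" where
  "word_len phi S g = (LEAST n. \<exists>ws. length ws = n \<and> set ws \<subseteq> S \<and> sd_prod phi ws = g)"

definition sphere :: "('k::ab_group_add \<Rightarrow> 'k) \<Rightarrow> ('k \<times> int) set \<Rightarrow> nat \<Rightarrow> ('k \<times> int) set" where
  "sphere phi S r = {g. word_len phi S g = r}"

definition ball :: "('k::ab_group_add \<Rightarrow> 'k) \<Rightarrow> ('k \<times> int) set \<Rightarrow> nat \<Rightarrow> ('k \<times> int) set" where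
  "ball phi S r = {g. word_len phi S g \<le> r}"

definition conj :: "('k::ab_group_add \<Rightarrow> 'k) \<Rightarrow> 'k \<times> int \<Rightarrow> 'k \<times> int \<Rightarrow> bool" where
  "conj phi g h = (\<exists>x. sd_mult phi x g = sd_mult phi h x)"

definition min_sphere :: "('k::ab_group_add \<Rightarrow> 'k) \<Rightarrow> ('k \<times> int) set \<Rightarrow> nat \<Rightarrow> ('k \<times> int) set" where
  "min_sphere phi S r = {g \<in> sphere phi S r. \<forall>h. conj phi g h \<longrightarrow> word_len phi S g \<le> word_len phi S h}"

definition num_classes :: "('k::ab_group_add \<Rightarrow> 'k) \<Rightarrow> ('k \<times> int) set \<Rightarrow> nat" where
  "num_classes phi A = card ((\<lambda>g. {h. conj phi g h}) ` A)"

definition exp_growth :: "('k::ab_group_add \<Rightarrow> 'k) \<Rightarrow> ('k \<times> int) set \<Rightarrow> bool" where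
  "exp_growth phi S = (\<exists>c::real. c > 1 \<and> (\<forall>r. c ^ r \<le> real (card (ball phi S r))))"

end

theory Submission
  imports Defs "HOL-Library.FuncSet" "HOL-Real_Asymp.Real_Asymp"
begin

text \<open>
  Let \<open>g\<close> be a minimal length conjugacy representative of length \<open>r\<close>, and consider the levels
  (exponents of \<open>t\<close>) visited by a geodesic word for \<open>g\<close>; let \<open>n\<close> be a small multiple of
  \<open>r / ln r\<close>. As \<open>K\<close> is abelian, an element whose geodesic visits at most \<open>n\<close> levels is determined
  by its exponent, the levels and the multiplicities of the generators on them, so there are only
  \<open>exp (O (n ln r))\<close> of these. Otherwise the rotations of the word starting at different levels are
  conjugate to \<open>g\<close> and, by minimality, again of length \<open>r\<close>. If at least a constant fraction of \<open>n\<close>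
  of them are distinct, the class occupies order \<open>r / ln r\<close> elements of the sphere. If not, then two
  rotations at nearby positions coincide, and the class contains an element commuting with a short
  element \<open>u = (y, s)\<close>, \<open>s \<noteq> 0\<close>. For given \<open>u\<close> and given exponent such elements differ by fixed
  points of \<open>\<phi>\<^sup>s\<close>. Since \<open>K\<close> is a Noetherian module over the Laurent polynomials, all periodic points
  of \<open>\<phi>\<close> lie in a submodule \<open>ker \<psi>\<^sup>N\<close> with \<open>\<psi> = \<phi>\<^sup>m - 1\<close> that meets \<open>\<psi>\<^sup>N K\<close> trivially, hence embeds in
  \<open>K / \<psi>\<^sup>N K\<close>, where words of length \<open>r\<close> represent only polynomially many elements.
\<close>

section \<open>Sums in abelian groups and subgroups of the integers\<close>

definition add_subgroup :: "'a::ab_group_add set \<Rightarrow> bool" where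
  "add_subgroup H \<longleftrightarrow> 0 \<in> H \<and> (\<forall>a\<in>H. \<forall>b\<in>H. a - b \<in> H)"

lemma add_subgroup_zero: "add_subgroup H \<Longrightarrow> 0 \<in> H"
  by (simp add: add_subgroup_def)

lemma add_subgroup_diff: "add_subgroup H \<Longrightarrow> a \<in> H \<Longrightarrow> b \<in> H \<Longrightarrow> a - b \<in> H"
  by (simp add: add_subgroup_def)

lemma add_subgroup_uminus: "add_subgroup H \<Longrightarrow> a \<in> H \<Longrightarrow> - a \<in> H"
  using add_subgroup_diff[of H 0 a] add_subgroup_zero by auto

lemma add_subgroup_add: "add_subgroup H \<Longrightarrow> a \<in> H \<Longrightarrow> b \<in> H \<Longrightarrow> a + b \<in> H"
  using add_subgroup_diff[of H a "- b"] add_subgroup_uminus by auto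

text \<open>The action of the integers on an abelian group; as \<open>nat\<close> is 0 on negative
  numbers, at most one of the two sums is nonempty.\<close>

definition int_scale :: "int \<Rightarrow> 'a::ab_group_add \<Rightarrow> 'a" where
  "int_scale c x = (\<Sum>i<nat c. x) - (\<Sum>i<nat (- c). x)"

lemma sum_const_add: "(\<Sum>i<m + n :: nat. x) = (\<Sum>i<m. x) + (\<Sum>i<n. x :: 'a::ab_group_add)"
  by (induction n) (auto simp: algebra_simps)

lemma int_scale_0 [simp]: "int_scale 0 x = 0" and int_scale_1 [simp]: "int_scale 1 x = x"
  by (simp_all add: int_scale_def)

lemma int_scale_diff: "int_scale (a - b) x = int_scale a x - int_scale b x"
proof -
  have "nat (a - b) + (nat (- a) + nat b) = nat (- (a - b)) + (nat a + nat (- b))"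
    by linarith
  from arg_cong[OF this, of "\<lambda>n. \<Sum>i<n. x"] show ?thesis
    unfolding int_scale_def sum_const_add by (simp add: algebra_simps)
qed

lemma int_subgroup_mult:
  assumes "add_subgroup (H :: int set)" "g \<in> H"
  shows "q * g \<in> H"
proof (induction q rule: int_induct[where k = 0])
  case base show ?case using assms by (simp add: add_subgroup_zero)
next
  case (step1 i) then show ?case using add_subgroup_add[OF assms(1) _ assms(2), of "i * g"] by (simp add: algebra_simps)
next
  case (step2 i) then show ?case using add_subgroup_diff[OF assms(1) _ assms(2), of "i * g"] by (simp add: algebra_simps)
qed

text \<open>The integers are Noetherian: by division with remainder the least positive element of
  the union divides all the others, so the chain is constant from a member that contains it.\<close>

lemma int_subgroup_chain_stable:
  fixes H :: "nat \<Rightarrow> int set"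
  assumes sub: "\<And>n. add_subgroup (H n)" and mono: "\<And>n. H n \<subseteq> H (Suc n)"
  shows "\<exists>N. \<forall>n. H n \<subseteq> H N"
proof (cases "\<exists>n. \<exists>x\<in>H n. x > 0")
  case False
  have "H n \<subseteq> {0}" for n
  proof
    fix x assume x: "x \<in> H n"
    then have "- x \<in> H n" using sub add_subgroup_uminus by blast
    with x False have "\<not> x > 0" "\<not> - x > 0" by blast+
    then show "x \<in> {0}" by auto
  qed
  then show ?thesis using add_subgroup_zero[OF sub[of 0]] by blast
next
  case True
  have le: "H m \<subseteq> H n" if "m \<le> n" for m n
    using lift_Suc_mono_le[of H, OF mono that] .
  define P where "P k \<longleftrightarrow> k > 0 \<and> (\<exists>n. int k \<in> H n)" for k :: nat
  have "\<exists>k. P k" using True unfolding P_def by (metis zero_less_imp_eq_int)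
  define g where "g = (LEAST k. P k)"
  have "P g" unfolding g_def using \<open>\<exists>k. P k\<close> by (rule LeastI_ex)
  then obtain N where g: "g > 0" "int g \<in> H N" unfolding P_def by blast
  have "H n \<subseteq> H N" for n
  proof
    fix x assume "x \<in> H n"
    then have x: "x \<in> H (max n N)" and g': "int g \<in> H (max n N)"
      using le g by (metis max.cobounded1 max.cobounded2 subsetD)+
    have "x mod int g = x - (x div int g) * int g" by (simp add: minus_div_mult_eq_mod)
    then have m: "x mod int g \<in> H (max n N)"
      using add_subgroup_diff[OF sub x int_subgroup_mult[OF sub g']] by simp
    have "x mod int g = 0"
    proof (rule ccontr)
      assume "x mod int g \<noteq> 0"
      moreover have "x mod int g \<ge> 0" "x mod int g < int g" using g by auto
      ultimately have "P (nat (x mod int g))" "nat (x mod int g) < g"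
        using m unfolding P_def by auto
      then show False unfolding g_def using not_less_Least by blast
    qed
    then have "x = (x div int g) * int g" by auto
    then show "x \<in> H N" using int_subgroup_mult[OF sub g(2)] by metis
  qed
  then show ?thesis by blast
qed

text \<open>The diagonal becomes stationary at some \<open>M\<close>, and \<open>L M M\<close> then
  bounds all columns \<open>k > M\<close> at once. The columns \<open>k \<le> M\<close> are finitely
  many, and each stabilises on its own.\<close>

lemma int_subgroup_family_stable:
  fixes L :: "nat \<Rightarrow> nat \<Rightarrow> int set"
  assumes sub: "\<And>n k. add_subgroup (L n k)"
    and mono1: "\<And>n k. L n k \<subseteq> L (Suc n) k" and mono2: "\<And>n k. L n k \<subseteq> L n (Suc k)"
  shows "\<exists>N. \<forall>n k. L n k \<subseteq> L N k"
proof -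
  have le1: "L m k \<subseteq> L n k" if "m \<le> n" for m n k
    using lift_Suc_mono_le[of "\<lambda>n. L n k", OF mono1 that] .
  have le2: "L n k \<subseteq> L n l" if "k \<le> l" for n k l
    using lift_Suc_mono_le[of "L n", OF mono2 that] .
  obtain M where M: "L n n \<subseteq> L M M" for n
    using int_subgroup_chain_stable[of "\<lambda>n. L n n"] sub mono1 mono2 by (metis subset_trans)
  obtain f where f: "L n k \<subseteq> L (f k) k" for n k
    using int_subgroup_chain_stable[of "\<lambda>n. L n k" for k] sub mono1 by metis
  define N where "N = Max (insert M (f ` {..M}))"
  have N: "M \<le> N" "k \<le> M \<Longrightarrow> f k \<le> N" for k
    unfolding N_def by (rule Max_ge; simp)+
  have "L n k \<subseteq> L N k" for n k
  proof (cases "k \<le> M")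
    case True
    then show ?thesis using f[of n k] le1[OF N(2)] by blast
  next
    case False
    have "L n k \<subseteq> L (max n k) (max n k)" using le1 le2 by (meson max.cobounded1 max.cobounded2 subset_trans)
    also have "\<dots> \<subseteq> L M M" by (rule M)
    also have "\<dots> \<subseteq> L N k" using le1[OF N(1)] le2[of M k] False by fastforce
    finally show ?thesis .
  qed
  then show ?thesis by blast
qed

section \<open>Sums with a bounded number of terms\<close>

definition bounded_sums :: "'a::ab_group_add set \<Rightarrow> nat \<Rightarrow> 'a set" where
  "bounded_sums X L = {sum_list ys | ys. set ys \<subseteq> X \<and> length ys \<le> L}"

lemma bounded_sums_zero: "0 \<in> bounded_sums X L"
  unfolding bounded_sums_def by (force intro: exI[of _ "[]"])

lemma bounded_sums_single: "x \<in> X \<Longrightarrow> 1 \<le> L \<Longrightarrow> x \<in> bounded_sums X L"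
  unfolding bounded_sums_def by (force intro!: exI[of _ "[x]"])

lemma bounded_sums_add:
  assumes "x \<in> bounded_sums X L" "y \<in> bounded_sums X M"
  shows "x + y \<in> bounded_sums X (L + M)"
proof -
  from assms obtain xs ys where "x = sum_list xs" "set xs \<subseteq> X" "length xs \<le> L"
    "y = sum_list ys" "set ys \<subseteq> X" "length ys \<le> M"
    unfolding bounded_sums_def by blast
  then show ?thesis unfolding bounded_sums_def by (force intro!: exI[of _ "xs @ ys"])
qed

lemma bounded_sums_mono: "X \<subseteq> Y \<Longrightarrow> L \<le> M \<Longrightarrow> bounded_sums X L \<subseteq> bounded_sums Y M"
  unfolding bounded_sums_def by fastforce

lemma bounded_sums_sum:
  assumes "\<And>i. i < n \<Longrightarrow> f i \<in> bounded_sums X L"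
  shows "(\<Sum>i<n. f i) \<in> bounded_sums X (n * L)"
  using assms
proof (induction n)
  case 0 show ?case by (simp add: bounded_sums_zero)
next
  case (Suc n)
  then have "(\<Sum>i<n. f i) + f n \<in> bounded_sums X (n * L + L)" by (intro bounded_sums_add) auto
  then show ?case by (simp add: add.commute)
qed

lemma sum_list_by_multiplicity:
  assumes "finite X" "set ys \<subseteq> X"
  shows "sum_list ys = (\<Sum>x\<in>X. \<Sum>i<count_list ys x. x :: 'a::ab_group_add)"
  using assms(2)
proof (induction ys)
  case Nil show ?case by simp
next
  case (Cons y ys)
  have "(\<Sum>x\<in>X. \<Sum>i<count_list (y # ys) x. x)
      = (\<Sum>x\<in>X. (if x = y then x else 0) + (\<Sum>i<count_list ys x. x))"
    by (rule sum.cong) auto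
  also have "\<dots> = y + sum_list ys"
    using Cons assms(1) by (simp add: sum.distrib)
  finally show ?case by simp
qed

text \<open>In an abelian group a sum depends only on the multiplicities of its terms, each between
  0 and \<open>L\<close>. This makes the count polynomial in \<open>L\<close>, although the lists
  are exponentially many.\<close>

lemma bounded_sums_finite_card:
  assumes "finite (X :: 'a::ab_group_add set)"
  shows "finite (bounded_sums X L)" and "card (bounded_sums X L) \<le> (L + 1) ^ card X"
proof -
  let ?F = "X \<rightarrow>\<^sub>E {..L}" and ?S = "\<lambda>f. \<Sum>x\<in>X. \<Sum>i<f x. x"
  have sub: "bounded_sums X L \<subseteq> ?S ` ?F"
  proof
    fix z assume "z \<in> bounded_sums X L"
    then obtain ys where ys: "z = sum_list ys" "set ys \<subseteq> X" "length ys \<le> L"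
      unfolding bounded_sums_def by blast
    have "z = ?S (restrict (count_list ys) X)"
      using sum_list_by_multiplicity[OF assms ys(2)] ys(1) by simp
    moreover have "restrict (count_list ys) X \<in> ?F"
      using ys(3) by (auto intro: order_trans[OF count_le_length])
    ultimately show "z \<in> ?S ` ?F" by blast
  qed
  have fin: "finite ?F" using assms by (intro finite_PiE) auto
  show "finite (bounded_sums X L)" using sub fin finite_subset by blast
  have "card (bounded_sums X L) \<le> card ?F"
    using sub fin by (meson card_image_le card_mono finite_imageI order_trans)
  then show "card (bounded_sums X L) \<le> (L + 1) ^ card X"
    using assms by (simp add: card_PiE)
qed

section \<open>Chains of submodules\<close>

locale additive_bij =
  fixes phi :: "'k::ab_group_add \<Rightarrow> 'k"
  assumes bij: "bij phi" and phi_add: "phi (a + b) = phi a + phi b"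
begin

lemma phi_0 [simp]: "phi 0 = 0"
  using phi_add[of 0 0] by simp

lemma phi_diff: "phi (a - b) = phi a - phi b"
  using phi_add[of "a - b" b] by (simp add: algebra_simps)

lemma phi_sum: "phi (sum f A) = (\<Sum>i\<in>A. phi (f i))"
  by (induction A rule: infinite_finite_induct) (simp_all add: phi_add)

lemma phi_int_scale: "phi (int_scale c x) = int_scale c (phi x)"
  by (simp add: int_scale_def phi_diff phi_sum)

lemma funpow_phi_0 [simp]: "(phi ^^ n) 0 = 0"
  by (induction n) auto

lemma funpow_phi_add: "(phi ^^ n) (a + b) = (phi ^^ n) a + (phi ^^ n) b"
  by (induction n) (auto simp: phi_add)

lemma funpow_phi_diff: "(phi ^^ n) (a - b) = (phi ^^ n) a - (phi ^^ n) b"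
  by (induction n) (auto simp: phi_diff)

lemma funpow_phi_sum: "(phi ^^ n) (sum f A) = (\<Sum>i\<in>A. (phi ^^ n) (f i))"
  by (induction n) (auto simp: phi_sum)

text \<open>A submodule over the Laurent polynomials, with the variable acting as
  \<open>phi\<close>; the equivalence covers closure under the inverse of \<open>phi\<close>
  too.\<close>

definition submodule :: "'k set \<Rightarrow> bool" where
  "submodule A \<longleftrightarrow> add_subgroup A \<and> (\<forall>a. phi a \<in> A \<longleftrightarrow> a \<in> A)"

lemma submodule_subgroup: "submodule A \<Longrightarrow> add_subgroup A"
  by (simp add: submodule_def)

lemma submodule_phi: "submodule A \<Longrightarrow> phi a \<in> A \<longleftrightarrow> a \<in> A"
  by (simp add: submodule_def)

lemma submodule_funpow: "submodule A \<Longrightarrow> (phi ^^ n) a \<in> A \<longleftrightarrow> a \<in> A"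
  by (induction n) (auto simp: submodule_phi)

definition module_hull :: "'k set \<Rightarrow> 'k set" where
  "module_hull X = \<Inter>{A. submodule A \<and> X \<subseteq> A}"

lemma submodule_module_hull: "submodule (module_hull X)"
  unfolding module_hull_def submodule_def add_subgroup_def by blast

lemma module_hull_superset: "X \<subseteq> module_hull X"
  unfolding module_hull_def by blast

lemma module_hull_least: "submodule A \<Longrightarrow> X \<subseteq> A \<Longrightarrow> module_hull X \<subseteq> A"
  unfolding module_hull_def by blast

text \<open>\<open>filt M x k\<close> is \<open>M\<close> plus the values at \<open>x\<close> of all
  integer polynomials in \<open>phi\<close> of degree less than \<open>k\<close>. Negative powers
  are excluded so that leading coefficients make sense.\<close>

primrec filt :: "'k set \<Rightarrow> 'k \<Rightarrow> nat \<Rightarrow> 'k set" where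
  "filt M x 0 = M"
| "filt M x (Suc k) = {f + int_scale c ((phi ^^ k) x) | f c. f \<in> filt M x k}"

lemma filt_step:
  "f \<in> filt M x k \<Longrightarrow> f + int_scale c ((phi ^^ k) x) \<in> filt M x (Suc k)"
  by auto

lemma filt_subgroup:
  assumes "add_subgroup M"
  shows "add_subgroup (filt M x k)"
proof (induction k)
  case 0 show ?case using assms by simp
next
  case (Suc k)
  show ?case unfolding add_subgroup_def
  proof (intro conjI ballI)
    show "0 \<in> filt M x (Suc k)"
      using filt_step[OF add_subgroup_zero[OF Suc], of 0] by simp
    fix a b assume "a \<in> filt M x (Suc k)" "b \<in> filt M x (Suc k)"
    then obtain f c g d where fg: "f \<in> filt M x k" "g \<in> filt M x k"
      and ab: "a = f + int_scale c ((phi ^^ k) x)" "b = g + int_scale d ((phi ^^ k) x)"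
      by auto
    have "a - b = (f - g) + int_scale (c - d) ((phi ^^ k) x)"
      unfolding ab int_scale_diff by simp
    then show "a - b \<in> filt M x (Suc k)"
      using filt_step[OF add_subgroup_diff[OF Suc fg]] by metis
  qed
qed

lemma filt_Suc_mono: "filt M x k \<subseteq> filt M x (Suc k)"
proof
  fix y assume "y \<in> filt M x k"
  from filt_step[OF this, of 0] show "y \<in> filt M x (Suc k)" by simp
qed

lemma filt_mono: "k \<le> l \<Longrightarrow> filt M x k \<subseteq> filt M x l"
  using lift_Suc_mono_le[of "filt M x"] filt_Suc_mono by metis

lemma filt_phi:
  assumes "submodule M" "y \<in> filt M x k"
  shows "phi y \<in> filt M x (Suc k)"
  using assms(2)
proof (induction k arbitrary: y)
  case 0
  then have "phi y \<in> filt M x 0" using assms(1) by (simp add: submodule_phi)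
  then show ?case using filt_Suc_mono by blast
next
  case (Suc k)
  then obtain f c where f: "f \<in> filt M x k" and y: "y = f + int_scale c ((phi ^^ k) x)" by auto
  have "phi y = phi f + int_scale c ((phi ^^ Suc k) x)" by (simp add: y phi_add phi_int_scale)
  then show ?case using filt_step[OF Suc.IH[OF f]] by metis
qed

lemma filt_funpow:
  assumes "submodule M" "y \<in> filt M x k"
  shows "(phi ^^ n) y \<in> filt M x (n + k)"
  by (induction n) (use assms filt_phi in auto)

text \<open>A high enough power of \<open>phi\<close> clears the negative powers of
  \<open>phi\<close> in front of \<open>x\<close>. The set of all \<open>y\<close> with this
  property is a submodule containing the generators.\<close>

lemma module_hull_insert:
  assumes "y \<in> module_hull (insert x X)"
  shows "\<exists>n k. (phi ^^ n) y \<in> filt (module_hull X) x k"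
proof -
  let ?M = "module_hull X"
  let ?B = "{y. \<exists>n k. (phi ^^ n) y \<in> filt ?M x k}"
  note M = submodule_module_hull[of X]
  note sub = filt_subgroup[OF submodule_subgroup[OF M], of x]
  have "submodule ?B" unfolding submodule_def add_subgroup_def
  proof (intro conjI ballI allI)
    show "0 \<in> ?B" using add_subgroup_zero[OF sub] by (auto intro: exI[of _ 0])
    fix a b assume "a \<in> ?B" "b \<in> ?B"
    then obtain n k m l where a: "(phi ^^ n) a \<in> filt ?M x k" and b: "(phi ^^ m) b \<in> filt ?M x l"
      by blast
    have "(phi ^^ (n + m)) a \<in> filt ?M x ((m + k) + (n + l))"
      using filt_funpow[OF M a, of m] filt_mono[of "m + k" "(m + k) + (n + l)"]
      unfolding add.commute[of n m] funpow_add o_apply by auto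
    moreover have "(phi ^^ (n + m)) b \<in> filt ?M x ((m + k) + (n + l))"
      using filt_funpow[OF M b, of n] filt_mono[of "n + l" "(m + k) + (n + l)"]
      unfolding funpow_add o_apply by auto
    ultimately have "(phi ^^ (n + m)) (a - b) \<in> filt ?M x ((m + k) + (n + l))"
      unfolding funpow_phi_diff by (rule add_subgroup_diff[OF sub])
    then show "a - b \<in> ?B" by blast
  next
    fix a
    show "phi a \<in> ?B \<longleftrightarrow> a \<in> ?B"
    proof
      assume "phi a \<in> ?B"
      then obtain n k where "(phi ^^ n) (phi a) \<in> filt ?M x k" by blast
      then have "(phi ^^ Suc n) a \<in> filt ?M x k" by (simp add: funpow_swap1)
      then show "a \<in> ?B" by blast
    next
      assume "a \<in> ?B"
      then obtain n k where "(phi ^^ n) a \<in> filt ?M x k" by blast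
      from filt_phi[OF M this] have "(phi ^^ n) (phi a) \<in> filt ?M x (Suc k)"
        by (simp add: funpow_swap1)
      then show "phi a \<in> ?B" by blast
    qed
  qed
  moreover have "insert x X \<subseteq> ?B"
  proof -
    have "(phi ^^ 0) z \<in> filt ?M x 0" if "z \<in> X" for z using that module_hull_superset by auto
    then have "X \<subseteq> ?B" by blast
    moreover have "(phi ^^ 0) x \<in> filt ?M x (Suc 0)"
      using filt_step[of 0 ?M x 0 1] add_subgroup_zero[OF sub, of 0] by simp
    then have "x \<in> ?B" by blast
    ultimately show ?thesis by blast
  qed
  ultimately show ?thesis using module_hull_least[of ?B] assms by blast
qed

text \<open>Hilbert's basis theorem for the module \<open>K\<close> over Laurent polynomials: the sets \<open>L n k\<close> in
  the proof consist of the leading coefficients of the elements of \<open>A n\<close> of degree \<open>k\<close> in the new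
  generator.\<close>

lemma submodule_chain_stable:
  assumes fin: "finite X"
    and A: "\<And>n. submodule (A n)" and mono: "\<And>n. A n \<subseteq> A (Suc n)"
  shows "\<exists>N. \<forall>n. A n \<inter> module_hull X \<subseteq> A N"
  using fin
proof (induction X)
  case empty
  have "submodule {0}" unfolding submodule_def add_subgroup_def
    using bij_is_inj[OF bij] by (auto dest: injD[of phi _ 0])
  from module_hull_least[OF this, of "{}"] have "module_hull {} \<subseteq> {0}" by simp
  then show ?case using add_subgroup_zero[OF submodule_subgroup[OF A]] by blast
next
  case (insert x X)
  let ?M = "module_hull X" and ?F = "filt (module_hull X) x"
  note sub = filt_subgroup[OF submodule_subgroup[OF submodule_module_hull[of X]], of x]
  note subA = submodule_subgroup[OF A]
  have le: "A m \<subseteq> A n" if "m \<le> n" for m n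
    using lift_Suc_mono_le[of A, OF mono that] .
  obtain N1 where N1: "A n \<inter> ?M \<subseteq> A N1" for n using insert.IH by blast
  define L where "L n k = {c. \<exists>f\<in>?F k. f + int_scale c ((phi ^^ k) x) \<in> A n}" for n k
  have "\<exists>N. \<forall>n k. L n k \<subseteq> L N k"
  proof (rule int_subgroup_family_stable)
    fix n k
    show "L n k \<subseteq> L (Suc n) k" unfolding L_def using mono by blast
    \<comment> \<open>Applying \<open>phi\<close> raises the degree by one and keeps the leading
      coefficient.\<close>
    show "L n k \<subseteq> L n (Suc k)"
    proof
      fix c assume "c \<in> L n k"
      then obtain f where f: "f \<in> ?F k" "f + int_scale c ((phi ^^ k) x) \<in> A n"
        unfolding L_def by blast
      then have "phi f \<in> ?F (Suc k)" "phi (f + int_scale c ((phi ^^ k) x)) \<in> A n"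
        using filt_phi[OF submodule_module_hull] submodule_phi[OF A] by blast+
      then show "c \<in> L n (Suc k)" unfolding L_def phi_add phi_int_scale by auto
    qed
    show "add_subgroup (L n k)" unfolding add_subgroup_def
    proof (intro conjI ballI)
      show "0 \<in> L n k" unfolding L_def
        using add_subgroup_zero[OF sub] add_subgroup_zero[OF subA] by force
      fix c d assume "c \<in> L n k" "d \<in> L n k"
      then obtain f g where "f \<in> ?F k" "f + int_scale c ((phi ^^ k) x) \<in> A n"
        "g \<in> ?F k" "g + int_scale d ((phi ^^ k) x) \<in> A n"
        unfolding L_def by blast
      then have "f - g \<in> ?F k"
        "(f + int_scale c ((phi ^^ k) x)) - (g + int_scale d ((phi ^^ k) x)) \<in> A n"
        using add_subgroup_diff[OF sub] add_subgroup_diff[OF subA] by blast+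
      moreover have "(f + int_scale c ((phi ^^ k) x)) - (g + int_scale d ((phi ^^ k) x))
        = (f - g) + int_scale (c - d) ((phi ^^ k) x)" by (simp add: int_scale_diff)
      ultimately show "c - d \<in> L n k" unfolding L_def by auto
    qed
  qed
  then obtain N2 where N2: "L n k \<subseteq> L N2 k" for n k by blast
  define N where "N = max N1 N2"
  \<comment> \<open>Induction on the degree: an element of \<open>A N\<close> with the same leading
    coefficient is subtracted; the difference has lower degree and still lies in
    \<open>A n\<close>.\<close>
  have step: "A n \<inter> ?F k \<subseteq> A N" for n k
  proof (induction k)
    case 0 show ?case using N1[of n] le[of N1 N] by (auto simp: N_def)
  next
    case (Suc k)
    show ?case
    proof
      fix y assume y: "y \<in> A n \<inter> ?F (Suc k)"
      then obtain f c where f: "f \<in> ?F k" and yf: "y = f + int_scale c ((phi ^^ k) x)" by auto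
      with y have "c \<in> L n k" unfolding L_def by blast
      with N2 have "c \<in> L N2 k" by blast
      then obtain g where g: "g \<in> ?F k" "g + int_scale c ((phi ^^ k) x) \<in> A N2"
        unfolding L_def by blast
      show "y \<in> A N"
      proof (cases "n \<le> N")
        case True then show ?thesis using le y by blast
      next
        case False
        have gN: "g + int_scale c ((phi ^^ k) x) \<in> A N" using g(2) le[of N2 N] by (auto simp: N_def)
        then have "g + int_scale c ((phi ^^ k) x) \<in> A n" using False le[of N n] by auto
        then have "y - (g + int_scale c ((phi ^^ k) x)) \<in> A n" using y add_subgroup_diff[OF subA] by blast
        then have "f - g \<in> A n" unfolding yf by simp
        with add_subgroup_diff[OF sub f g(1)] Suc have "f - g \<in> A N" by blast
        from add_subgroup_add[OF subA this gN] show ?thesis unfolding yf by simp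
      qed
    qed
  qed
  have "A n \<inter> module_hull (insert x X) \<subseteq> A N" for n
  proof
    fix y assume y: "y \<in> A n \<inter> module_hull (insert x X)"
    then obtain m k where "(phi ^^ m) y \<in> ?F k" using module_hull_insert by blast
    moreover have "(phi ^^ m) y \<in> A n" using y submodule_funpow[OF A] by blast
    ultimately show "y \<in> A N" using step submodule_funpow[OF A] by blast
  qed
  then show ?case by blast
qed

subsection \<open>Periodic points\<close>

definition delta :: "nat \<Rightarrow> 'k \<Rightarrow> 'k" where
  "delta s x = (phi ^^ s) x - x"

lemma delta_diff: "delta s (a - b) = delta s a - delta s b"
  by (simp add: delta_def funpow_phi_diff)

lemma delta_add: "delta s (a + b) = delta s a + delta s b"
  by (simp add: delta_def funpow_phi_add)

lemma delta_phi: "delta s (phi a) = phi (delta s a)"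
  by (simp add: delta_def phi_diff funpow_swap1)

lemma funpow_delta_0 [simp]: "(delta s ^^ n) 0 = 0"
  by (induction n) (auto simp: delta_def)

lemma funpow_delta_diff: "(delta s ^^ n) (a - b) = (delta s ^^ n) a - (delta s ^^ n) b"
  by (induction n) (auto simp: delta_diff)

lemma funpow_delta_phi: "(delta s ^^ n) (phi a) = phi ((delta s ^^ n) a)"
  by (induction n) (auto simp: delta_phi)

definition ker_delta :: "nat \<Rightarrow> nat \<Rightarrow> 'k set" where
  "ker_delta s n = {z. (delta s ^^ n) z = 0}"

lemma submodule_ker_delta: "submodule (ker_delta s n)"
proof -
  have "phi a = 0 \<longleftrightarrow> a = 0" for a
    using bij_is_inj[OF bij] by (auto dest: injD[of phi _ 0])
  then show ?thesis
    unfolding submodule_def add_subgroup_def ker_delta_def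
    by (simp add: funpow_delta_diff funpow_delta_phi)
qed

text \<open>By telescoping, \<open>delta s\<close> is a factor of \<open>delta (s * q)\<close>; the
  cofactor is a sum of powers of \<open>phi\<close>, which preserve \<open>A\<close>.\<close>

lemma delta_mult_in:
  assumes "submodule A" "delta s z \<in> A"
  shows "delta (s * q) z \<in> A"
proof (induction q)
  case 0 show ?case using assms(1) by (simp add: delta_def add_subgroup_zero submodule_subgroup)
next
  case (Suc q)
  have "delta (s * Suc q) z = (phi ^^ (s * q)) (delta s z) + delta (s * q) z"
    by (simp add: delta_def funpow_phi_diff funpow_add[symmetric] add.commute o_def[symmetric]
        flip: o_apply[of "phi ^^ _" "phi ^^ _"])
  then show ?case
    using Suc assms submodule_funpow add_subgroup_add[OF submodule_subgroup[OF assms(1)]] by auto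
qed

lemma ker_delta_Suc: "z \<in> ker_delta s (Suc n) \<longleftrightarrow> delta s z \<in> ker_delta s n"
  by (simp add: ker_delta_def funpow_swap1)

lemma ker_delta_dvd: "ker_delta s n \<subseteq> ker_delta (s * q) n"
proof -
  have "z \<in> ker_delta s n \<Longrightarrow> z \<in> ker_delta (s * q) n" for z
  proof (induction n arbitrary: z)
    case 0 then show ?case by (simp add: ker_delta_def)
  next
    case (Suc n)
    then have "delta (s * q) z \<in> ker_delta s n"
      using delta_mult_in[OF submodule_ker_delta] by (simp add: ker_delta_Suc)
    then show ?case using Suc.IH by (simp add: ker_delta_Suc)
  qed
  then show ?thesis by blast
qed

lemma ker_delta_mono: "n \<le> m \<Longrightarrow> ker_delta s n \<subseteq> ker_delta s m"
  by (rule lift_Suc_mono_le[of "ker_delta s"]) (auto simp: ker_delta_def delta_def)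

lemma ker_delta_dvd_mono:
  assumes "s dvd s'" "n \<le> m"
  shows "ker_delta s n \<subseteq> ker_delta s' m"
proof -
  from assms(1) obtain q where "s' = s * q" by (rule dvdE)
  with ker_delta_dvd[of s n q] ker_delta_mono[OF assms(2), of s'] show ?thesis by blast
qed

text \<open>Both chain conditions, on the periods and on the kernels of the powers of a single
  \<open>delta s\<close>, follow from the stability of the one chain \<open>ker_delta (fact n) n\<close>.\<close>

lemma periodic_submodule:
  assumes "finite X" "module_hull X = UNIV"
  obtains s n where "s > 0"
    and "\<And>i z. i > 0 \<Longrightarrow> (phi ^^ i) z = z \<Longrightarrow> z \<in> ker_delta s n"
    and "\<And>w. (delta s ^^ n) w \<in> ker_delta s n \<Longrightarrow> (delta s ^^ n) w = 0"
proof -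
  \<comment> \<open>\<open>fact n\<close> is a multiple of every positive period up to
    \<open>n\<close> and divides all later factorials, which makes the chain increasing.\<close>
  define A where "A n = ker_delta (fact n) n" for n :: nat
  have mono: "A n \<subseteq> A m" if "n \<le> m" for n m
    unfolding A_def by (rule ker_delta_dvd_mono) (use that in \<open>auto intro: fact_dvd\<close>)
  obtain N where N: "A n \<subseteq> A N" for n
    using submodule_chain_stable[OF assms(1), of A] assms(2) submodule_ker_delta
      mono[OF le_SucI[OF order_refl]]
    unfolding A_def by auto
  show thesis
  proof
    show "fact N > (0::nat)" by simp
    fix i :: nat and z assume i: "i > 0" "(phi ^^ i) z = z"
    then have "z \<in> ker_delta i 1" by (simp add: ker_delta_def delta_def)
    also have "ker_delta i 1 \<subseteq> A i"
      unfolding A_def using i by (intro ker_delta_dvd_mono) (auto intro: dvd_fact)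
    finally show "z \<in> ker_delta (fact N) N" using N by (auto simp: A_def)
  next
    fix w assume "(delta (fact N) ^^ N) w \<in> ker_delta (fact N) N"
    \<comment> \<open>The composed power \<open>N + N\<close> places \<open>w\<close> in a later
      member of the chain, and stability brings it back to the power \<open>N\<close>.\<close>
    then have "w \<in> ker_delta (fact N) (N + N)" by (simp add: ker_delta_def funpow_add)
    also have "\<dots> \<subseteq> A (N + N)"
      unfolding A_def by (intro ker_delta_dvd_mono) (auto intro: fact_dvd)
    finally show "(delta (fact N) ^^ N) w = 0" using N by (auto simp: A_def ker_delta_def)
  qed
qed

section \<open>Polynomial growth modulo the image of a power of \<open>delta s\<close>\<close>

lemma delta_sum: "delta s (sum f A) = (\<Sum>i\<in>A. delta s (f i))"
  by (simp add: delta_def funpow_phi_sum sum_subtractf)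

lemma funpow_delta_sum: "(delta s ^^ n) (sum f A) = (\<Sum>i\<in>A. (delta s ^^ n) (f i))"
  by (induction n) (auto simp: delta_sum)

lemma bounded_sums_delta:
  assumes "x \<in> bounded_sums X L"
  shows "delta s x \<in> bounded_sums (delta s ` X) L"
proof -
  from assms obtain ys where ys: "x = sum_list ys" "set ys \<subseteq> X" "length ys \<le> L"
    unfolding bounded_sums_def by blast
  have "delta s (sum_list zs) = sum_list (map (delta s) zs)" for zs
    by (induction zs) (simp_all add: delta_def funpow_phi_add)
  then show ?thesis
    unfolding bounded_sums_def using ys by (auto intro!: exI[of _ "map (delta s) ys"] imageI)
qed

text \<open>Since \<open>phi ^^ s\<close> is the identity plus \<open>delta s\<close>, the binomial
  expansion of its \<open>q\<close>-th power modulo the image of \<open>delta s ^^ n\<close> keeps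
  only the exponents \<open>j < n\<close>, with coefficients polynomial in \<open>q\<close>. The
  induction on \<open>n\<close> tracks just the total number of terms.\<close>

lemma funpow_mod_delta:
  "\<exists>e w. e \<in> bounded_sums ((\<lambda>j. (delta s ^^ j) y) ` {..<n}) ((q + 1) ^ n)
     \<and> (phi ^^ (q * s)) y = e + (delta s ^^ n) w"
proof (induction n arbitrary: q)
  case 0
  show ?case by (intro exI[of _ 0] exI[of _ "(phi ^^ (q * s)) y"]) (auto intro: bounded_sums_zero)
next
  case (Suc n)
  let ?X = "\<lambda>n. (\<lambda>j. (delta s ^^ j) y) ` {..<n}"
  have X: "delta s ` ?X n \<subseteq> ?X (Suc n)"
  proof
    fix x assume "x \<in> delta s ` ?X n"
    then obtain j where "j < n" "x = (delta s ^^ Suc j) y" by auto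
    then show "x \<in> ?X (Suc n)" by (intro image_eqI[of _ _ "Suc j"]) auto
  qed
  obtain e w where e: "e p \<in> bounded_sums (?X n) ((p + 1) ^ n)"
    and w: "(phi ^^ (p * s)) y = e p + (delta s ^^ n) (w p)" for p
    using Suc.IH by metis
  let ?w = "\<Sum>p<q. w p" and ?e = "y + (\<Sum>p<q. delta s (e p))"
  \<comment> \<open>Telescoping over \<open>p < q\<close>. The induction hypothesis expands each
    summand, and the extra \<open>delta s\<close> raises the power from \<open>n\<close> to
    \<open>Suc n\<close>.\<close>
  have "(phi ^^ (q * s)) y = y + (\<Sum>p<q. delta s ((phi ^^ (p * s)) y))"
    by (induction q) (simp_all add: delta_def funpow_add)
  also have "\<dots> = y + delta s ((\<Sum>p<q. e p) + (delta s ^^ n) ?w)"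
    unfolding w sum.distrib funpow_delta_sum delta_sum[symmetric] ..
  also have "\<dots> = ?e + (delta s ^^ Suc n) ?w"
    by (simp add: delta_add delta_sum)
  finally have "(phi ^^ (q * s)) y = ?e + (delta s ^^ Suc n) ?w" .
  moreover have "?e \<in> bounded_sums (?X (Suc n)) ((q + 1) ^ Suc n)"
  proof -
    have "delta s (e p) \<in> bounded_sums (?X (Suc n)) (q ^ n)" if "p < q" for p
    proof -
      have "(p + 1) ^ n \<le> q ^ n" using that by (intro power_mono) auto
      then show ?thesis using bounded_sums_delta[OF e] bounded_sums_mono[OF X] by blast
    qed
    then have "(\<Sum>p<q. delta s (e p)) \<in> bounded_sums (?X (Suc n)) (q * q ^ n)"
      by (rule bounded_sums_sum)
    moreover have "y \<in> bounded_sums (?X (Suc n)) 1"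
      by (rule bounded_sums_single) (auto intro: image_eqI[of _ _ 0])
    ultimately have "?e \<in> bounded_sums (?X (Suc n)) (1 + q * q ^ n)"
      by (intro bounded_sums_add)
    moreover have "1 + q * q ^ n \<le> (q + 1) ^ Suc n"
    proof -
      have "q * q ^ n \<le> q * (q + 1) ^ n" by (intro mult_left_mono power_mono) auto
      moreover have "1 \<le> (q + 1) ^ n" by simp
      ultimately have "1 + q * q ^ n \<le> (q + 1) ^ n + q * (q + 1) ^ n" by (rule add_mono[rotated])
      then show ?thesis by simp
    qed
    ultimately show ?thesis using bounded_sums_mono by blast
  qed
  ultimately show ?case by blast
qed

text \<open>The shape of the \<open>K\<close>-coordinate of a word of length at most
  \<open>r\<close> after applying \<open>phi ^^ r\<close>, which moves the levels from
  \<open>- r..r\<close> to \<open>0..2 * r\<close>.\<close>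

definition funpow_sums :: "'k set \<Rightarrow> nat \<Rightarrow> 'k set" where
  "funpow_sums X r = {\<Sum>j<r. (phi ^^ f j) (x j) | f x. (\<forall>j<r. f j \<le> 2 * r \<and> x j \<in> X)}"

text \<open>By \<open>Q\<close> the kernel meets the image of \<open>delta s ^^ n\<close> only in 0,
  so elements of one coset of the kernel are told apart by their classes modulo the image. These
  classes have representatives \<open>e\<close> that are sums of polynomially many elements of the
  finite set \<open>?Y\<close>, whose size is bounded independently of \<open>r\<close>.\<close>

lemma coset_growth_polynomial:
  assumes fin: "finite X" and s: "s > 0"
    and Q: "\<And>w. (delta s ^^ n) w \<in> ker_delta s n \<Longrightarrow> (delta s ^^ n) w = 0"
    and B: "B \<subseteq> funpow_sums X r" and coset: "\<And>k k'. k \<in> B \<Longrightarrow> k' \<in> B \<Longrightarrow> k - k' \<in> ker_delta s n"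
  shows "finite B" and "card B \<le> (r * (2 * r + 1) ^ n + 1) ^ (n * s * card X)"
proof -
  let ?Y = "(\<lambda>(j, i, x). (delta s ^^ j) ((phi ^^ i) x)) ` ({..<n} \<times> {..<s} \<times> X)"
  let ?L = "(2 * r + 1) ^ n"
  have one: "\<exists>e w. e \<in> bounded_sums ?Y ?L \<and> (phi ^^ i) x = e + (delta s ^^ n) w"
    if "i \<le> 2 * r" "x \<in> X" for i x
  proof -
    \<comment> \<open>Dividing \<open>i\<close> by \<open>s\<close> leaves only the starting points
      \<open>(phi ^^ (i mod s)) x\<close>, whose number does not grow with \<open>r\<close>.\<close>
    let ?y = "(phi ^^ (i mod s)) x"
    have "(i div s + 1) ^ n \<le> ?L"
      using that(1) div_le_dividend[of i s] by (intro power_mono) linarith+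
    moreover have "(\<lambda>j. (delta s ^^ j) ?y) ` {..<n} \<subseteq> ?Y"
      using s that(2) by (force intro!: image_eqI[of _ _ "(_, i mod s, x)"])
    ultimately have "bounded_sums ((\<lambda>j. (delta s ^^ j) ?y) ` {..<n}) ((i div s + 1) ^ n) \<subseteq> bounded_sums ?Y ?L"
      by (intro bounded_sums_mono)
    moreover have "(phi ^^ (i div s * s)) ?y = (phi ^^ i) x"
      by (metis funpow_add o_apply div_mult_mod_eq)
    moreover obtain e w where "e \<in> bounded_sums ((\<lambda>j. (delta s ^^ j) ?y) ` {..<n}) ((i div s + 1) ^ n)"
      and "(phi ^^ (i div s * s)) ?y = e + (delta s ^^ n) w"
      using funpow_mod_delta[of s ?y n "i div s"] by blast
    ultimately have "e \<in> bounded_sums ?Y ?L" "(phi ^^ i) x = e + (delta s ^^ n) w"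
      by (blast, simp only:)
    then show ?thesis by blast
  qed
  have "\<exists>e w. e \<in> bounded_sums ?Y (r * ?L) \<and> k = e + (delta s ^^ n) w" if "k \<in> B" for k
  proof -
    from that B obtain f x where k: "k = (\<Sum>j<r. (phi ^^ f j) (x j))"
      and fx: "\<And>j. j < r \<Longrightarrow> f j \<le> 2 * r \<and> x j \<in> X"
      unfolding funpow_sums_def by blast
    have "\<forall>j. \<exists>e w. j < r \<longrightarrow> e \<in> bounded_sums ?Y ?L \<and> (phi ^^ f j) (x j) = e + (delta s ^^ n) w"
      using one fx by blast
    then obtain e w where ew: "\<And>j. j < r \<Longrightarrow> e j \<in> bounded_sums ?Y ?L
        \<and> (phi ^^ f j) (x j) = e j + (delta s ^^ n) (w j)"
      unfolding choice_iff by blast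
    then have "k = (\<Sum>j<r. e j) + (delta s ^^ n) (\<Sum>j<r. w j)"
      unfolding k by (simp add: funpow_delta_sum sum.distrib)
    moreover have "(\<Sum>j<r. e j) \<in> bounded_sums ?Y (r * ?L)"
      using ew by (intro bounded_sums_sum) auto
    ultimately show ?thesis by blast
  qed
  then have "\<forall>k. \<exists>e w. k \<in> B \<longrightarrow> e \<in> bounded_sums ?Y (r * ?L) \<and> k = e + (delta s ^^ n) w" by blast
  then obtain e w where ew: "\<And>k. k \<in> B \<Longrightarrow> e k \<in> bounded_sums ?Y (r * ?L) \<and> k = e k + (delta s ^^ n) (w k)"
    unfolding choice_iff by blast
  have inj: "inj_on e B"
  proof (rule inj_onI)
    fix k k' assume k: "k \<in> B" "k' \<in> B" "e k = e k'"
    then have d: "k - k' = (delta s ^^ n) (w k - w k')"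
      using ew[of k] ew[of k'] unfolding funpow_delta_diff by (metis add_diff_cancel_left)
    then have "(delta s ^^ n) (w k - w k') = 0" using coset[OF k(1,2)] by (intro Q) simp
    with d show "k = k'" by simp
  qed
  have finY: "finite ?Y" using fin by auto
  note BS = bounded_sums_finite_card[OF finY, of "r * ?L"]
  have sub: "e ` B \<subseteq> bounded_sums ?Y (r * ?L)" using ew by blast
  show "finite B" using inj_on_finite[OF inj sub BS(1)] .
  have "card B \<le> (r * ?L + 1) ^ card ?Y" using card_inj_on_le[OF inj sub BS(1)] BS(2) by linarith
  also have "card ?Y \<le> n * s * card X"
    using card_image_le[of "{..<n} \<times> {..<s} \<times> X"] fin by (simp add: card_cartesian_product mult.assoc)
  then have "(r * ?L + 1) ^ card ?Y \<le> (r * ?L + 1) ^ (n * s * card X)"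
    by (intro power_increasing) auto
  finally show "card B \<le> (r * (2 * r + 1) ^ n + 1) ^ (n * s * card X)" .
qed

subsection \<open>Counting elements of the semidirect product\<close>

abbreviation pow :: "int \<Rightarrow> 'k \<Rightarrow> 'k" where "pow \<equiv> phi_pow phi"
abbreviation mult :: "'k \<times> int \<Rightarrow> 'k \<times> int \<Rightarrow> 'k \<times> int" where "mult \<equiv> sd_mult phi"
abbreviation eval :: "('k \<times> int) list \<Rightarrow> 'k \<times> int" where "eval \<equiv> sd_prod phi"

lemma pow_of_nat: "pow (int n) = phi ^^ n"
  by (simp add: phi_pow_def)

lemma pow_0 [simp]: "pow 0 x = x"
  by (simp add: phi_pow_def)

lemma pow_Suc: "pow (m + 1) x = phi (pow m x)"
proof (cases "m \<ge> 0")
  case True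
  then have "nat (m + 1) = Suc (nat m)" by linarith
  with True show ?thesis by (simp add: phi_pow_def)
next
  case False
  then have "nat (- m) = Suc (nat (- (m + 1)))" by linarith
  with False show ?thesis
    using bij_is_surj[OF bij] by (auto simp: phi_pow_def surj_f_inv_f)
qed

lemma phi_eq_iff: "phi a = phi b \<longleftrightarrow> a = b"
  using bij_is_inj[OF bij] by (simp add: inj_eq)

lemma pow_add: "pow (a + b) x = pow a (pow b x)"
proof (induction a rule: int_induct[where k = 0])
  case base show ?case by simp
next
  case (step1 i)
  then show ?case using pow_Suc[of "i + b" x] pow_Suc[of i] by (simp add: algebra_simps)
next
  case (step2 i)
  have "phi (pow (i - 1 + b) x) = phi (pow (i - 1) (pow b x))"
    using step2 pow_Suc[of "i - 1 + b" x] pow_Suc[of "i - 1" "pow b x"] by (simp add: algebra_simps)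
  then show ?case by (simp add: phi_eq_iff)
qed

lemma pow_plus: "pow m (a + b) = pow m a + pow m b"
proof (induction m rule: int_induct[where k = 0])
  case base show ?case by simp
next
  case (step1 i)
  then show ?case by (simp add: pow_Suc phi_add)
next
  case (step2 i)
  have "phi (pow (i - 1) (a + b)) = phi (pow (i - 1) a + pow (i - 1) b)"
    using step2 pow_Suc[of "i - 1"] by (simp add: phi_add)
  then show ?case by (simp add: phi_eq_iff)
qed

lemma pow_zero [simp]: "pow m 0 = 0"
  using pow_plus[of m 0 0] by simp

lemma pow_diff: "pow m (a - b) = pow m a - pow m b"
  using pow_plus[of m "a - b" b] by (simp add: algebra_simps)

lemma pow_uminus: "pow m (- a) = - pow m a"
  using pow_diff[of m 0 a] by simp

lemma pow_sum: "pow m (sum f A) = (\<Sum>i\<in>A. pow m (f i))"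
  by (induction A rule: infinite_finite_induct) (simp_all add: pow_plus)

lemma pow_fixed_abs:
  assumes "pow s x = x"
  shows "(phi ^^ nat \<bar>s\<bar>) x = x"
proof -
  have "pow (- s) x = x" using pow_add[of "- s" s x] assms by simp
  then have "pow \<bar>s\<bar> x = x" using assms by (cases "s \<ge> 0") auto
  then show ?thesis using pow_of_nat[of "nat \<bar>s\<bar>"] by simp
qed

lemma mult_assoc: "mult (mult x y) z = mult x (mult y z)"
  by (simp add: sd_mult_def pow_plus pow_add add.assoc)

lemma mult_one [simp]: "mult (0, 0) x = x" "mult x (0, 0) = x"
  by (simp_all add: sd_mult_def)

lemma mult_inverse: "\<exists>y. mult x y = (0, 0) \<and> mult y x = (0, 0)"
proof -
  have "mult x (- pow (- snd x) (fst x), - snd x) = (0, 0)"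
    using pow_add[of "snd x" "- snd x" "fst x"] by (simp add: sd_mult_def pow_uminus)
  moreover have "mult (- pow (- snd x) (fst x), - snd x) x = (0, 0)"
    by (simp add: sd_mult_def)
  ultimately show ?thesis by blast
qed

definition conj_class :: "'k \<times> int \<Rightarrow> ('k \<times> int) set" where
  "conj_class g = {h. Defs.conj phi g h}"

lemma conj_sym:
  assumes "Defs.conj phi g h"
  shows "Defs.conj phi h g"
proof -
  from assms obtain x where x: "mult x g = mult h x" unfolding Defs.conj_def by blast
  obtain y where y: "mult x y = (0, 0)" "mult y x = (0, 0)" using mult_inverse by blast
  have "mult y h = mult y (mult (mult h x) y)" by (simp add: mult_assoc y)
  also have "\<dots> = mult (mult y x) (mult g y)" by (simp add: mult_assoc flip: x)
  also have "\<dots> = mult g y" by (simp add: y)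
  finally show ?thesis unfolding Defs.conj_def by blast
qed

lemma conj_trans:
  assumes "Defs.conj phi g h" "Defs.conj phi h l"
  shows "Defs.conj phi g l"
proof -
  from assms obtain x y where x: "mult x g = mult h x" and y: "mult y h = mult l y"
    unfolding Defs.conj_def by blast
  have "mult (mult y x) g = mult l (mult y x)" by (metis mult_assoc x y)
  then show ?thesis unfolding Defs.conj_def by blast
qed

lemma conj_class_eq: "h \<in> conj_class g \<Longrightarrow> conj_class g = conj_class h"
  unfolding conj_class_def using conj_sym conj_trans by blast

lemma eval_append: "eval (xs @ ys) = mult (eval xs) (eval ys)"
  by (induction xs) (simp_all add: mult_assoc)

lemma eval_rotate_conj: "eval (ys @ xs) \<in> conj_class (eval (xs @ ys))"
proof -
  have "mult (eval ys) (eval (xs @ ys)) = mult (eval (ys @ xs)) (eval ys)"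
    by (simp add: eval_append mult_assoc)
  then show ?thesis unfolding conj_class_def Defs.conj_def by blast
qed

lemma snd_mult [simp]: "snd (mult x y) = snd x + snd y"
  by (simp add: sd_mult_def)

text \<open>Each letter contributes its \<open>K\<close>-coordinate moved by the level of the prefix
  before it. As \<open>K\<close> is abelian, it only matters which letters are read on which level,
  not their order.\<close>

lemma fst_eval:
  "fst (eval ws) = (\<Sum>j<length ws. pow (snd (eval (take j ws))) (fst (ws ! j)))"
proof (induction ws)
  case Nil show ?case by simp
next
  case (Cons w ws)
  have "fst (eval (w # ws)) = fst w + pow (snd w) (\<Sum>j<length ws. pow (snd (eval (take j ws))) (fst (ws ! j)))"
    by (simp add: sd_mult_def flip: Cons)
  then show ?case
    by (simp add: sum.lessThan_Suc_shift pow_sum pow_add del: sum.lessThan_Suc)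
qed

end

section \<open>Words, balls and spheres in \<open>G\<close>\<close>

locale semidirect = additive_bij phi for phi :: "'k::ab_group_add \<Rightarrow> 'k" +
  fixes R :: "'k set"
  assumes fin_R: "finite R"
    and gen: "\<exists>ws. set ws \<subseteq> gen_set R \<and> eval ws = g"
begin

abbreviation "S \<equiv> gen_set R"
abbreviation "len \<equiv> word_len phi S"

lemma fst_gen: "w \<in> S \<Longrightarrow> fst w \<in> insert 0 R"
  by (auto simp: gen_set_def)

lemma finite_gen: "finite S"
proof -
  have "S = (\<lambda>r. (r, 0)) ` R \<union> {(0, 1), (0, -1)}" by (auto simp: gen_set_def)
  then show ?thesis using fin_R by simp
qed

lemma abs_snd_eval: "set ws \<subseteq> S \<Longrightarrow> \<bar>snd (eval ws)\<bar> \<le> int (length ws)"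
proof (induction ws)
  case (Cons w ws)
  then have "\<bar>snd w\<bar> \<le> 1" "\<bar>snd (eval ws)\<bar> \<le> int (length ws)" by (auto simp: gen_set_def)
  then show ?case by simp
qed simp

definition words :: "nat \<Rightarrow> ('k \<times> int) set" where
  "words n = {eval ws | ws. set ws \<subseteq> S \<and> length ws \<le> n}"

lemma geodesic:
  obtains ws where "set ws \<subseteq> S" "length ws = len g" "eval ws = g"
proof -
  have "\<exists>n ws. length ws = n \<and> set ws \<subseteq> S \<and> eval ws = g" using gen by blast
  from LeastI_ex[OF this] show thesis using that unfolding word_len_def by blast
qed

lemma len_le: "set ws \<subseteq> S \<Longrightarrow> len (eval ws) \<le> length ws"
  unfolding word_len_def by (rule Least_le) blast

lemma ball_eq_words: "Defs.ball phi S r = words r"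
proof -
  have "g \<in> words r" if "len g \<le> r" for g
  proof -
    obtain ws where "set ws \<subseteq> S" "length ws = len g" "eval ws = g" by (rule geodesic)
    with that show ?thesis unfolding words_def by auto
  qed
  moreover have "len g \<le> r" if "g \<in> words r" for g
    using that len_le unfolding words_def by fastforce
  ultimately show ?thesis unfolding ball_def by blast
qed

lemma words_eq_image: "words n = eval ` {ws. set ws \<subseteq> S \<and> length ws \<le> n}"
  by (auto simp: words_def)

lemma finite_words: "finite (words n)"
  unfolding words_eq_image using finite_lists_length_le[OF finite_gen] by blast

lemma card_words: "card (words n) \<le> (n + 1) * card S ^ n"
proof -
  have "card (words n) \<le> card {ws. set ws \<subseteq> S \<and> length ws \<le> n}"
    unfolding words_eq_image by (intro card_image_le finite_lists_length_le finite_gen)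
  also have "\<dots> = (\<Sum>i\<le>n. card S ^ i)" by (rule card_lists_length_le[OF finite_gen])
  also have "\<dots> \<le> (\<Sum>i\<le>n. card S ^ n)"
  proof (intro sum_mono power_increasing)
    show "1 \<le> card S" using finite_gen by (auto simp: Suc_le_eq card_gt_0_iff gen_set_def)
  qed auto
  finally show ?thesis by simp
qed

lemma sphere_subset_words: "sphere phi S r \<subseteq> words r"
  unfolding ball_eq_words[symmetric] by (auto simp: sphere_def ball_def)

lemma finite_sphere: "finite (sphere phi S r)"
  using sphere_subset_words finite_words finite_subset by blast

text \<open>A geodesic cut after \<open>a\<close> letters falls into two geodesics, since a shorter
  word for either part would shorten the whole. This submultiplicativity later turns growth of balls
  into growth of spheres.\<close>

lemma card_sphere_add:
  "card (sphere phi S (a + b)) \<le> card (sphere phi S a) * card (sphere phi S b)"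
proof -
  have "sphere phi S (a + b) \<subseteq> (\<lambda>(x, y). mult x y) ` (sphere phi S a \<times> sphere phi S b)"
  proof
    fix g assume "g \<in> sphere phi S (a + b)"
    then have g: "len g = a + b" by (simp add: sphere_def)
    obtain ws where ws: "set ws \<subseteq> S" "length ws = len g" "eval ws = g" by (rule geodesic)
    let ?x = "eval (take a ws)" and ?y = "eval (drop a ws)"
    have xy: "g = mult ?x ?y" using ws(3) by (simp flip: eval_append)
    have sub: "set (take a ws) \<subseteq> S" "set (drop a ws) \<subseteq> S"
      using ws(1) set_take_subset set_drop_subset by fast+
    have le: "len ?x \<le> a" "len ?y \<le> b"
      using len_le[OF sub(1)] len_le[OF sub(2)] ws(2) g by auto
    obtain xs where xs: "set xs \<subseteq> S" "length xs = len ?x" "eval xs = ?x" by (rule geodesic)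
    obtain ys where ys: "set ys \<subseteq> S" "length ys = len ?y" "eval ys = ?y" by (rule geodesic)
    have "a + b \<le> len ?x + len ?y"
      using len_le[of "xs @ ys"] xs ys g xy by (simp add: eval_append)
    with le have "len ?x = a" "len ?y = b" by auto
    with xy show "g \<in> (\<lambda>(x, y). mult x y) ` (sphere phi S a \<times> sphere phi S b)"
      by (force simp: sphere_def)
  qed
  then have "card (sphere phi S (a + b)) \<le> card (sphere phi S a \<times> sphere phi S b)"
    using finite_sphere by (meson card_image_le card_mono finite_SigmaI finite_imageI order_trans)
  then show ?thesis by (simp add: card_cartesian_product)
qed

section \<open>Elements given by words on few levels\<close>

definition levels :: "('k \<times> int) list \<Rightarrow> int set" where
  "levels ws = (\<lambda>j. snd (eval (take j ws))) ` {..<length ws}"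

lemma level_bound:
  assumes "set ws \<subseteq> S" "j \<le> length ws"
  shows "snd (eval (take j ws)) \<in> {- int (length ws)..int (length ws)}"
proof -
  have "set (take j ws) \<subseteq> S" using assms(1) set_take_subset by fast
  then have "\<bar>snd (eval (take j ws))\<bar> \<le> int (length (take j ws))" by (rule abs_snd_eval)
  then show ?thesis using assms(2) by auto
qed

definition few_levels :: "nat \<Rightarrow> nat \<Rightarrow> ('k \<times> int) set" where
  "few_levels r n = {eval ws | ws. set ws \<subseteq> S \<and> length ws = r \<and> card (levels ws) \<le> n}"

text \<open>Such an element is determined by its exponent of \<open>t\<close> and by
  \<open>n\<close> pairs of a level and the sum of the letters read on it. The factors count the
  exponents, the levels and, by multiplicities, the sums.\<close>

lemma few_levels_finite_card:
  "finite (few_levels r n)"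
  "card (few_levels r n) \<le> (2 * r + 1) * ((2 * r + 1) * (r + 1) ^ card (insert 0 R)) ^ n"
proof -
  let ?I = "{- int r..int r}" and ?E = "bounded_sums (insert 0 R) r"
  let ?P = "{ps. set ps \<subseteq> ?I \<times> ?E \<and> length ps = n}"
  let ?h = "\<lambda>(m, ps). (\<Sum>(v, y)\<leftarrow>ps. pow v y, m)"
  have finE: "finite ?E" and cardE: "card ?E \<le> (r + 1) ^ card (insert 0 R)"
    using bounded_sums_finite_card[of "insert 0 R" r] fin_R by auto
  have cardI: "card ?I = 2 * r + 1" by simp
  have sub: "few_levels r n \<subseteq> ?h ` (?I \<times> ?P)"
  proof
    fix g assume "g \<in> few_levels r n"
    then obtain ws where ws: "set ws \<subseteq> S" "length ws = r" "card (levels ws) \<le> n" and g: "g = eval ws"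
      unfolding few_levels_def by blast
    let ?l = "\<lambda>j. snd (eval (take j ws))"
    define F where "F v = (\<Sum>j<r. if ?l j = v then fst (ws ! j) else 0)" for v
    have finL: "finite (levels ws)" by (simp add: levels_def)
    obtain vs where vs: "set vs = levels ws" "distinct vs" using finite_distinct_list[OF finL] by blast
    \<comment> \<open>The pairs \<open>(0, 0)\<close> contribute nothing and bring the list to
      length exactly \<open>n\<close>, so that lists of one fixed length are counted.\<close>
    define ps where "ps = map (\<lambda>v. (v, F v)) vs @ replicate (n - length vs) (0, 0)"
    have F: "F v \<in> ?E" for v
    proof -
      have "F v \<in> bounded_sums (insert 0 R) (r * 1)"
        unfolding F_def
      proof (rule bounded_sums_sum)
        fix j assume "j < r"
        then have "ws ! j \<in> S" using ws by auto
        then show "(if ?l j = v then fst (ws ! j) else 0) \<in> bounded_sums (insert 0 R) 1"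
          using fst_gen[of "ws ! j"] by (simp add: bounded_sums_zero bounded_sums_single del: insert_iff)
      qed
      then show ?thesis by simp
    qed
    have lenvs: "length vs = card (levels ws)" using vs distinct_card by metis
    have "set vs \<subseteq> ?I" unfolding vs levels_def using level_bound[OF ws(1)] ws(2) by force
    then have "set ps \<subseteq> ?I \<times> ?E" unfolding ps_def using F bounded_sums_zero by auto
    moreover have "length ps = n" unfolding ps_def using ws(3) lenvs by simp
    ultimately have ps: "ps \<in> ?P" by blast
    have "fst g = (\<Sum>j<r. pow (?l j) (fst (ws ! j)))" using fst_eval[of ws] ws(2) g by simp
    \<comment> \<open>Every letter is read on exactly one of the levels, so the sum can be
      rearranged level by level.\<close>
    also have "\<dots> = (\<Sum>j<r. \<Sum>v\<in>levels ws. if ?l j = v then pow v (fst (ws ! j)) else 0)"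
      using finL ws(2) by (intro sum.cong) (auto simp: levels_def)
    also have "\<dots> = (\<Sum>v\<in>levels ws. \<Sum>j<r. if ?l j = v then pow v (fst (ws ! j)) else 0)"
      by (rule sum.swap)
    also have "\<dots> = (\<Sum>v\<in>levels ws. pow v (F v))"
      unfolding F_def pow_sum by (intro sum.cong refl) auto
    also have "\<dots> = (\<Sum>(v, y)\<leftarrow>ps. pow v y)"
    proof -
      have "sum_list (replicate i 0) = (0 :: 'k)" for i by (induction i) auto
      then show ?thesis
        unfolding ps_def using vs
        by (simp add: o_def sum_list_distinct_conv_sum_set map_replicate_const)
    qed
    finally have "fst g = (\<Sum>(v, y)\<leftarrow>ps. pow v y)" .
    moreover have "snd g \<in> ?I" using level_bound[OF ws(1), of r] ws(2) g by simp
    ultimately show "g \<in> ?h ` (?I \<times> ?P)" using ps by (intro image_eqI[of _ _ "(snd g, ps)"]) (auto simp: prod_eq_iff)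
  qed
  have finP: "finite (?I \<times> ?P)" using finE by (simp add: finite_lists_length_eq)
  show "finite (few_levels r n)" by (rule finite_subset[OF sub finite_imageI[OF finP]])
  have "card (few_levels r n) \<le> card (?I \<times> ?P)"
    using sub finP by (meson card_image_le card_mono finite_imageI order_trans)
  also have "\<dots> = (2 * r + 1) * ((2 * r + 1) * card ?E) ^ n"
    using finE by (simp only: card_cartesian_product card_lists_length_eq finite_cartesian_product finite_atLeastAtMost_int cardI)
  also have "\<dots> \<le> (2 * r + 1) * ((2 * r + 1) * (r + 1) ^ card (insert 0 R)) ^ n"
    using cardE by (intro mult_left_mono power_mono) auto
  finally show "card (few_levels r n) \<le> (2 * r + 1) * ((2 * r + 1) * (r + 1) ^ card (insert 0 R)) ^ n" .
qed

section \<open>Elements commuting with a short element outside \<open>K\<close>\<close>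

lemma funpow_fst_words:
  assumes "g \<in> words r"
  shows "(phi ^^ r) (fst g) \<in> funpow_sums (insert 0 R) r"
proof -
  from assms obtain ws where ws: "set ws \<subseteq> S" "length ws \<le> r" "eval ws = g" unfolding words_def by blast
  let ?l = "\<lambda>j. snd (eval (take j ws))"
  \<comment> \<open>The offset \<open>r\<close> makes the exponents natural numbers; positions
    beyond the end of the word are filled with zeros to reach exactly \<open>r\<close>
    terms.\<close>
  define f where "f j = (if j < length ws then nat (int r + ?l j) else 0)" for j
  define x where "x j = (if j < length ws then fst (ws ! j) else 0)" for j
  have l: "0 \<le> int r + ?l j" "int r + ?l j \<le> 2 * int r" if "j < length ws" for j
    using level_bound[OF ws(1), of j] ws(2) that by auto
  have "(phi ^^ r) (fst g) = (\<Sum>j<length ws. (phi ^^ r) (pow (?l j) (fst (ws ! j))))"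
    using fst_eval[of ws] ws(3) by (simp add: funpow_phi_sum)
  also have "\<dots> = (\<Sum>j<length ws. (phi ^^ f j) (x j))"
  proof (rule sum.cong)
    fix j assume "j \<in> {..<length ws}"
    then show "(phi ^^ r) (pow (?l j) (fst (ws ! j))) = (phi ^^ f j) (x j)"
      using l[of j] by (simp add: f_def x_def pow_add flip: pow_of_nat)
  qed simp
  also have "\<dots> = (\<Sum>j<r. (phi ^^ f j) (x j))"
    using ws(2) by (intro sum.mono_neutral_left) (auto simp: x_def)
  finally have "(phi ^^ r) (fst g) = (\<Sum>j<r. (phi ^^ f j) (x j))" .
  moreover have "f j \<le> 2 * r \<and> x j \<in> insert 0 R" for j
  proof (cases "j < length ws")
    case True
    then have "ws ! j \<in> S" using ws(1) nth_mem by blast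
    with True show ?thesis using l[OF True] fst_gen[of "ws ! j"] by (auto simp: f_def x_def simp del: insert_iff)
  qed (simp add: f_def x_def)
  ultimately show ?thesis unfolding funpow_sums_def by blast
qed

definition commuting :: "nat \<Rightarrow> nat \<Rightarrow> ('k \<times> int) set" where
  "commuting r D = {h \<in> words r. \<exists>u \<in> words D. snd u \<noteq> 0 \<and> mult u h = mult h u}"

text \<open>Finite generation of \<open>K\<close> as a module, on which the chain condition rests:
  the \<open>K\<close>-coordinate of a word is a sum of images of elements of
  \<open>insert 0 R\<close> under powers of \<open>phi\<close>.\<close>

lemma module_hull_R: "module_hull (insert 0 R) = UNIV"
proof -
  let ?M = "module_hull (insert 0 R)"
  note M = submodule_module_hull[of "insert 0 R"]
  have pow: "pow m x \<in> ?M" if x: "x \<in> ?M" for m x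
  proof (induction m rule: int_induct[where k = 0])
    case base show ?case using x by simp
  next
    case (step1 i) then show ?case using submodule_phi[OF M] by (simp add: pow_Suc)
  next
    case (step2 i) then show ?case using submodule_phi[OF M, of "pow (i - 1) x"] pow_Suc[of "i - 1" x] by simp
  qed
  have "k \<in> ?M" for k
  proof -
    obtain ws where ws: "set ws \<subseteq> S" "eval ws = (k, 0)" using gen by blast
    have "set vs \<subseteq> S \<Longrightarrow> fst (eval vs) \<in> ?M" for vs
    proof (induction vs)
      case Nil show ?case by (simp add: add_subgroup_zero submodule_subgroup M)
    next
      case (Cons v vs)
      then have "fst v \<in> ?M" using fst_gen[of v] module_hull_superset[of "insert 0 R"] by auto
      with Cons show ?case
        using pow add_subgroup_add[OF submodule_subgroup[OF M]] by (simp add: sd_mult_def)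
    qed
    from this[OF ws(1)] show ?thesis using ws(2) by simp
  qed
  then show ?thesis by blast
qed

lemma commuting_finite: "finite (commuting r D)"
  unfolding commuting_def using finite_words by simp

text \<open>For fixed \<open>u\<close> and fixed exponent, the \<open>K\<close>-coordinates of two
  elements commuting with \<open>u\<close> differ by a fixed point of a positive power of
  \<open>phi\<close>. They lie in one coset of \<open>ker_delta s n\<close>, where growth is
  polynomial. The other factors count \<open>u\<close> and the exponent; \<open>n\<close> and
  \<open>m\<close> are the same for all \<open>r\<close> and \<open>D\<close>.\<close>

lemma card_commuting:
  obtains n m where "\<And>r D. card (commuting r D) \<le> card (words D) * ((2 * r + 1) * (r * (2 * r + 1) ^ n + 1) ^ m)"
proof -
  obtain s n where s: "s > 0"
    and per: "\<And>i z. i > 0 \<Longrightarrow> (phi ^^ i) z = z \<Longrightarrow> z \<in> ker_delta s n"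
    and triv: "\<And>w. (delta s ^^ n) w \<in> ker_delta s n \<Longrightarrow> (delta s ^^ n) w = 0"
    using periodic_submodule[of "insert 0 R"] fin_R module_hull_R by blast
  define m where "m = n * s * card (insert 0 R)"
  have "card (commuting r D) \<le> card (words D) * ((2 * r + 1) * (r * (2 * r + 1) ^ n + 1) ^ m)" for r D
  proof -
    let ?N = "(r * (2 * r + 1) ^ n + 1) ^ m" and ?I = "{- int r..int r}"
    define U where "U = {u \<in> words D. snd u \<noteq> 0}"
    define H where "H u i = {k. (k, i) \<in> words r \<and> mult u (k, i) = mult (k, i) u}" for u i
    have H: "finite (H u i)" "card (H u i) \<le> ?N" if "u \<in> U" for u i
    proof -
      \<comment> \<open>The injective map \<open>phi ^^ r\<close> makes all exponents nonnegative,
        preserves cardinality, and keeps differences in the submodule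
        \<open>ker_delta s n\<close>.\<close>
      let ?B = "(phi ^^ r) ` H u i"
      have "?B \<subseteq> funpow_sums (insert 0 R) r"
        unfolding H_def using funpow_fst_words[of "(_, i)" r] by auto
      moreover have "k - k' \<in> ker_delta s n" if "k \<in> ?B" "k' \<in> ?B" for k k'
      proof -
        from that obtain a b where ab: "a \<in> H u i" "b \<in> H u i"
          and k: "k = (phi ^^ r) a" "k' = (phi ^^ r) b" by blast
        from ab have "fst u + pow (snd u) a = a + pow i (fst u)" "fst u + pow (snd u) b = b + pow i (fst u)"
          unfolding H_def by (simp_all add: sd_mult_def)
        then have "pow (snd u) a = a + pow i (fst u) - fst u" "pow (snd u) b = b + pow i (fst u) - fst u"
          by (metis add_diff_cancel_left')+
        then have "pow (snd u) (a - b) = a - b" unfolding pow_diff by simp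
        from pow_fixed_abs[OF this] have "a - b \<in> ker_delta s n"
          using \<open>u \<in> U\<close> by (intro per[of "nat \<bar>snd u\<bar>"]) (auto simp: U_def)
        then show ?thesis
          using submodule_funpow[OF submodule_ker_delta] unfolding k funpow_phi_diff[symmetric] by blast
      qed
      ultimately have B: "finite ?B" "card ?B \<le> ?N"
        using coset_growth_polynomial[of "insert 0 R" s n ?B r] fin_R s triv unfolding m_def by auto
      have inj: "inj_on (phi ^^ r) (H u i)"
        using bij_is_inj[OF bij] by (meson inj_fn inj_on_subset subset_UNIV)
      show "finite (H u i)" using finite_imageD[OF B(1) inj] .
      show "card (H u i) \<le> ?N" using B(2) card_image[OF inj] by simp
    qed
    have finU: "finite U" unfolding U_def using finite_words by simp
    have "commuting r D \<subseteq> (\<Union>u\<in>U. \<Union>i\<in>?I. (\<lambda>k. (k, i)) ` H u i)"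
    proof
      fix h assume "h \<in> commuting r D"
      then obtain u where h: "h \<in> words r" and u: "u \<in> U" "mult u h = mult h u"
        unfolding commuting_def U_def by blast
      have "\<bar>snd h\<bar> \<le> int r" using h abs_snd_eval unfolding words_def by fastforce
      then have "snd h \<in> ?I" by auto
      moreover have "fst h \<in> H u (snd h)" using h u unfolding H_def by simp
      moreover have "h = (fst h, snd h)" by simp
      ultimately show "h \<in> (\<Union>u\<in>U. \<Union>i\<in>?I. (\<lambda>k. (k, i)) ` H u i)" using u(1) by blast
    qed
    moreover have "finite (\<Union>u\<in>U. \<Union>i\<in>?I. (\<lambda>k. (k, i)) ` H u i)" using finU H(1) by auto
    ultimately have "card (commuting r D) \<le> card (\<Union>u\<in>U. \<Union>i\<in>?I. (\<lambda>k. (k, i)) ` H u i)"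
      by (rule card_mono[rotated])
    also have "\<dots> \<le> (\<Sum>u\<in>U. card (\<Union>i\<in>?I. (\<lambda>k. (k, i)) ` H u i))" by (rule card_UN_le[OF finU])
    also have "\<dots> \<le> (\<Sum>u\<in>U. \<Sum>i\<in>?I. card ((\<lambda>k. (k, i)) ` H u i))"
      by (intro sum_mono card_UN_le) simp
    also have "\<dots> \<le> (\<Sum>u\<in>U. \<Sum>i\<in>?I. ?N)"
      using H card_image_le order_trans by (intro sum_mono) blast
    also have "\<dots> = card U * ((2 * r + 1) * ?N)"
    proof -
      have "card ?I = 2 * r + 1" by simp
      then show ?thesis by (simp only: sum_constant of_nat_id)
    qed
    also have "\<dots> \<le> card (words D) * ((2 * r + 1) * ?N)"
      using finite_words by (intro mult_right_mono card_mono) (auto simp: U_def)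
    finally show ?thesis .
  qed
  then show thesis by (rule that)
qed

section \<open>Rotations of geodesics and the count of classes\<close>

lemma eval_rotations_coincide:
  assumes ws: "set ws \<subseteq> S" and j: "j < j'" "j' \<le> length ws" "j' - j \<le> D"
    and lev: "snd (eval (take j ws)) \<noteq> snd (eval (take j' ws))"
    and eq: "eval (drop j ws @ take j ws) = eval (drop j' ws @ take j' ws)"
  shows "eval (drop j ws @ take j ws) \<in> commuting (length ws) D"
proof -
  \<comment> \<open>\<open>us\<close> is the part of the word between the two positions. The
    rotations are \<open>us @ vs\<close> and \<open>vs @ us\<close>, so their equality means that
    \<open>us\<close> commutes with \<open>us @ vs\<close>; the different levels give
    \<open>us\<close> a nonzero exponent.\<close>
  define us where "us = take (j' - j) (drop j ws)"
  define vs where "vs = drop j' ws @ take j ws"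
  have us: "take j' ws = take j ws @ us" "drop j ws = us @ drop j' ws"
    unfolding us_def using j take_add[of j "j' - j" ws] append_take_drop_id[of "j' - j" "drop j ws"] by auto
  then have uv: "drop j ws @ take j ws = us @ vs" "drop j' ws @ take j' ws = vs @ us"
    unfolding vs_def by simp_all
  have "set us \<subseteq> S" unfolding us_def using ws by (meson in_set_dropD in_set_takeD subset_iff)
  then have "eval us \<in> words D" using j unfolding words_def us_def by (auto intro!: exI)
  moreover have "snd (eval us) \<noteq> 0" using lev by (simp add: us eval_append)
  moreover have "mult (eval us) (eval (us @ vs)) = mult (eval (us @ vs)) (eval us)"
  proof -
    have "mult (eval us) (eval (us @ vs)) = mult (eval us) (eval (vs @ us))" using eq by (simp add: uv)
    then show ?thesis by (simp add: eval_append mult_assoc)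
  qed
  moreover have "eval (drop j ws @ take j ws) \<in> words (length ws)"
  proof -
    have "set (drop j ws @ take j ws) \<subseteq> S" "length (drop j ws @ take j ws) \<le> length ws"
      using ws j by (auto dest: in_set_dropD in_set_takeD)
    then show ?thesis unfolding words_def by blast
  qed
  ultimately show ?thesis unfolding commuting_def uv by blast
qed

text \<open>The geodesic is cut into \<open>T\<close> blocks; the rotations starting at the different levels visited in
  one block are conjugate and geodesic, and a coincidence of two of them yields a short element
  outside \<open>K\<close> that commutes with the rotation.\<close>

lemma min_sphere_trichotomy:
  assumes g: "g \<in> min_sphere phi S r" and T: "T > 0" and q: "q * T \<le> n"
  shows "g \<in> few_levels r n \<or> (\<exists>h\<in>commuting r (r div T + 1). conj_class g = conj_class h)
    \<or> q \<le> card (conj_class g \<inter> sphere phi S r)"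
proof -
  let ?D = "r div T + 1"
  have glen: "len g = r" and gmin: "\<And>h. h \<in> conj_class g \<Longrightarrow> r \<le> len h"
    using g by (auto simp: min_sphere_def sphere_def conj_class_def)
  obtain ws where ws: "set ws \<subseteq> S" "length ws = r" "eval ws = g"
    using geodesic[of g] glen by metis
  let ?l = "\<lambda>j. snd (eval (take j ws))"
  let ?c = "\<lambda>j. eval (drop j ws @ take j ws)"
  have c_class: "?c j \<in> conj_class g" for j
    using eval_rotate_conj[of "drop j ws" "take j ws"] ws(3) by simp
  \<comment> \<open>Rotations are words of length \<open>r\<close> for conjugates of
    \<open>g\<close>, and by minimality no conjugate is shorter.\<close>
  have c: "?c j \<in> conj_class g \<inter> sphere phi S r" for j
  proof -
    have "set (drop j ws @ take j ws) \<subseteq> S" "length (drop j ws @ take j ws) = r"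
      using ws by (auto dest: in_set_dropD in_set_takeD)
    then have "len (?c j) \<le> r" using len_le by metis
    then show ?thesis using c_class gmin by (simp add: sphere_def le_antisym)
  qed
  show ?thesis
  proof (cases "card (levels ws) \<le> n")
    case True
    then show ?thesis using ws unfolding few_levels_def by blast
  next
    case False
    have "\<forall>v\<in>levels ws. \<exists>j. j < r \<and> ?l j = v" unfolding levels_def ws(2) by auto
    then obtain t where t: "\<And>v. v \<in> levels ws \<Longrightarrow> t v < r \<and> ?l (t v) = v" by metis
    have rD: "r < T * ?D" using T mod_less_divisor[OF T, of r] mult_div_mod_eq[of T r] by (simp only: distrib_left mult_1_right)
    have "t v div ?D < T" if "v \<in> levels ws" for v
    proof (rule less_mult_imp_div_less)
      show "t v < T * ?D" using t[OF that] rD by (blast intro: less_trans)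
    qed
    then have "(\<lambda>v. t v div ?D) \<in> levels ws \<rightarrow> {..<T}" by simp
    moreover have "finite (levels ws)" by (simp add: levels_def)
    \<comment> \<open>Pigeonhole: more than \<open>q * T\<close> levels are spread over
      \<open>T\<close> blocks, so the chosen positions of at least \<open>q\<close> levels fall into
      one block.\<close>
    ultimately obtain b where
      b: "card (levels ws) \<le> card ((\<lambda>v. t v div ?D) -` {b} \<inter> levels ws) * card {..<T}"
      using pigeonhole_card[of "\<lambda>v. t v div ?D" "levels ws" "{..<T}"] T by auto
    define V where "V = (\<lambda>v. t v div ?D) -` {b} \<inter> levels ws"
    have "q * T < card V * T" using b False q unfolding V_def card_lessThan by linarith
    then have qV: "q \<le> card V" by simp
    show ?thesis
    proof (cases "inj_on (\<lambda>v. ?c (t v)) V")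
      case True
      have "card V \<le> card (conj_class g \<inter> sphere phi S r)"
        using c finite_sphere by (intro card_inj_on_le[OF True]) auto
      then show ?thesis using qV by linarith
    next
      case False
      then obtain v w where vw: "v \<in> V" "w \<in> V" "?c (t v) = ?c (t w)" "v \<noteq> w"
        unfolding inj_on_def by blast
      have lv: "?l (t v) = v" "?l (t w) = w" "t v < r" "t w < r" using t vw unfolding V_def by auto
      have near: "t v div ?D = b" "t w div ?D = b" using vw unfolding V_def by auto
      have le: "x - y \<le> ?D" if "x div ?D = b" "y div ?D = b" for x y
      proof -
        have "x = b * ?D + x mod ?D" "y = b * ?D + y mod ?D" using that by (metis div_mult_mod_eq)+
        moreover have "x mod ?D < ?D" by simp
        ultimately show ?thesis by linarith
      qed
      have "t v \<noteq> t w" using lv vw(4) by metis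
      then have "\<exists>j. ?c j \<in> commuting r ?D"
      proof (cases "t v < t w")
        case True
        then show ?thesis
          using eval_rotations_coincide[OF ws(1) True _ le[OF near(2,1)]] lv vw ws(2) by auto
      next
        case F: False
        then have "t w < t v" using \<open>t v \<noteq> t w\<close> by simp
        then show ?thesis
          using eval_rotations_coincide[OF ws(1) _ _ le[OF near]] lv vw ws(2) by auto
      qed
      then show ?thesis using conj_class_eq[OF c_class] by blast
    qed
  qed
qed

text \<open>Distinct classes are disjoint, so \<open>q\<close> times the number of those with at
  least \<open>q\<close> elements on the sphere is at most the size of the sphere. Every other class
  has a representative in one of the two exceptional sets.\<close>

lemma num_classes_bound:
  assumes T: "T > 0" and q: "q * T \<le> n"
  shows "q * num_classes phi (min_sphere phi S r)
    \<le> card (sphere phi S r) + q * (card (few_levels r n) + card (commuting r (r div T + 1)))"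
proof -
  let ?S = "sphere phi S r" and ?A = "few_levels r n" and ?Z = "commuting r (r div T + 1)"
  let ?C = "conj_class ` min_sphere phi S r"
  define G where "G = {C \<in> ?C. q \<le> card (C \<inter> ?S)}"
  have finC: "finite ?C" by (rule finite_imageI) (auto intro: finite_subset[OF _ finite_sphere] simp: min_sphere_def)
  have finG: "finite G" unfolding G_def using finC by simp
  have "?C \<subseteq> conj_class ` ?A \<union> conj_class ` ?Z \<union> G"
  proof
    fix C assume C: "C \<in> ?C"
    then obtain g where g: "g \<in> min_sphere phi S r" "C = conj_class g" by blast
    from min_sphere_trichotomy[OF g(1) T q] consider "g \<in> ?A"
      | h where "h \<in> ?Z" "C = conj_class h" | "q \<le> card (C \<inter> ?S)"
      unfolding g(2) by blast
    then show "C \<in> conj_class ` ?A \<union> conj_class ` ?Z \<union> G"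
      by cases (use C g(2) in \<open>simp_all add: G_def\<close>)
  qed
  then have "card ?C \<le> card (conj_class ` ?A \<union> conj_class ` ?Z \<union> G)"
    using finG few_levels_finite_card(1) commuting_finite by (intro card_mono) auto
  also have "\<dots> \<le> card (conj_class ` ?A) + card (conj_class ` ?Z) + card G"
    by (meson card_Un_le add_right_mono order_trans)
  also have "\<dots> \<le> card ?A + card ?Z + card G"
    using few_levels_finite_card(1) commuting_finite by (intro add_mono card_image_le) auto
  finally have "q * card ?C \<le> q * (card ?A + card ?Z) + q * card G"
    by (metis distrib_left mult_le_mono2)
  moreover have "q * card G \<le> card ?S"
  proof -
    have "q * card G \<le> (\<Sum>C\<in>G. card (C \<inter> ?S))"
      using sum_bounded_below[of G q "\<lambda>C. card (C \<inter> ?S)"] by (auto simp: G_def mult.commute)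
    also have "\<dots> = card (\<Union>C\<in>G. C \<inter> ?S)"
    proof (rule card_UN_disjoint[symmetric])
      show "\<forall>C\<in>G. \<forall>D\<in>G. C \<noteq> D \<longrightarrow> (C \<inter> ?S) \<inter> (D \<inter> ?S) = {}"
        unfolding G_def using conj_class_eq by blast
    qed (use finG finite_sphere in auto)
    also have "\<dots> \<le> card ?S" using finite_sphere by (intro card_mono) auto
    finally show ?thesis .
  qed
  moreover have nc: "num_classes phi (min_sphere phi S r) = card ?C"
    by (simp add: num_classes_def conj_class_def)
  ultimately show ?thesis unfolding nc by linarith
qed

subsection \<open>Asymptotics\<close>

text \<open>If one sphere of radius \<open>r\<close> had fewer than \<open>d ^ r\<close> elements,
  submultiplicativity would spread this bound to all radii up to a constant. Balls of radius
  \<open>N\<close> would then have order at most \<open>N * d ^ N\<close>, against the lower bound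
  \<open>c ^ N\<close>.\<close>

lemma sphere_lower_bound:
  assumes "exp_growth phi S"
  obtains d :: real where "d > 1" "\<And>r. d ^ r \<le> real (card (sphere phi S r))"
proof -
  let ?s = "\<lambda>r. real (card (sphere phi S r))"
  from assms obtain c :: real where c: "c > 1" "\<And>r. c ^ r \<le> real (card (words r))"
    unfolding exp_growth_def ball_eq_words by blast
  \<comment> \<open>The square root gives \<open>c ^ N = d ^ N * d ^ N\<close>; cancelling one
    factor leaves an exponential bounded by a linear function.\<close>
  define d where "d = sqrt c"
  have d: "d > 1" "d ^ 2 = c" using c(1) by (auto simp: d_def)
  have "d ^ r \<le> ?s r" for r
  proof (rule ccontr)
    assume "\<not> d ^ r \<le> ?s r"
    then have lt: "?s r < d ^ r" by simp
    have "(0, 0) \<in> sphere phi S 0" using len_le[of "[]"] by (simp add: sphere_def)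
    then have "1 \<le> ?s 0" using finite_sphere[of 0] by (auto simp: Suc_le_eq card_gt_0_iff)
    with lt have r: "r > 0" by (cases r) auto
    \<comment> \<open>\<open>M\<close> bounds the spheres of radius \<open>j mod r\<close>, the
      remainder after splitting off multiples of \<open>r\<close>.\<close>
    define M where "M = (\<Sum>i<r. ?s i)"
    have M: "?s i \<le> M" if "i < r" for i
      unfolding M_def using that by (intro member_le_sum) auto
    have M0: "M \<ge> 1" using M[of 0] r \<open>1 \<le> ?s 0\<close> by linarith
    have add: "?s (a + b) \<le> ?s a * ?s b" for a b
      using card_sphere_add[of a b] by (metis of_nat_le_iff of_nat_mult)
    have mult: "?s (q * r + i) \<le> ?s r ^ q * ?s i" for q i
    proof (induction q)
      case (Suc q)
      have "?s (Suc q * r + i) \<le> ?s r * ?s (q * r + i)" using add[of r "q * r + i"] by (simp add: add.assoc)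
      also have "\<dots> \<le> ?s r * (?s r ^ q * ?s i)" using Suc by (intro mult_left_mono) auto
      finally show ?case by (simp add: mult.assoc)
    qed simp
    have s: "?s j \<le> M * d ^ j" for j
    proof -
      have "?s j \<le> ?s r ^ (j div r) * ?s (j mod r)" using mult[of "j div r" "j mod r"] by simp
      also have "\<dots> \<le> (d ^ r) ^ (j div r) * M"
        using lt M[of "j mod r"] r d(1) by (intro mult_mono power_mono) auto
      also have "\<dots> \<le> M * d ^ j"
        using d(1) M0 div_times_less_eq_dividend[of j r]
        by (simp add: mult.commute flip: power_mult)
      finally show ?thesis .
    qed
    have cN: "c ^ N \<le> (real N + 1) * (M * d ^ N)" for N
    proof -
      have "words N \<subseteq> (\<Union>j\<le>N. sphere phi S j)"
        unfolding ball_eq_words[symmetric] by (auto simp: ball_def sphere_def)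
      then have "card (words N) \<le> card (\<Union>j\<le>N. sphere phi S j)"
        using finite_sphere by (intro card_mono) auto
      also have "\<dots> \<le> (\<Sum>j\<le>N. card (sphere phi S j))" by (rule card_UN_le) simp
      finally have "real (card (words N)) \<le> real (\<Sum>j\<le>N. card (sphere phi S j))" by (simp only: of_nat_le_iff)
      also have "\<dots> = (\<Sum>j\<le>N. ?s j)" by simp
      also have "\<dots> \<le> (\<Sum>j\<le>N. M * d ^ N)"
        using s M0 d(1) by (intro sum_mono order_trans[OF s] mult_left_mono power_increasing) auto
      also have "\<dots> = (real N + 1) * (M * d ^ N)" by (simp add: add.commute)
      finally show ?thesis using c(2)[of N] by linarith
    qed
    have bound: "d ^ N \<le> (real N + 1) * M" for N
    proof -
      have "d ^ N * d ^ N \<le> ((real N + 1) * M) * d ^ N"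
        using cN[of N]
        by (simp flip: d(2) add: power2_eq_square power_mult_distrib mult.assoc)
      then show ?thesis using d(1) by simp
    qed
    have "((\<lambda>N. (real N + 1) * M / d ^ N) \<longlongrightarrow> 0) sequentially"
      using d(1) by real_asymp
    then have "eventually (\<lambda>N. (real N + 1) * M / d ^ N < 1) sequentially"
      by (rule order_tendstoD) simp
    then obtain N where "(real N + 1) * M / d ^ N < 1" by (auto simp: eventually_sequentially)
    then show False using bound[of N] d(1) by (simp add: divide_less_eq)
  qed
  with d(1) show thesis by (rule that)
qed

text \<open>Dividing the class bound by \<open>q\<close> and by the size of the sphere leaves
  \<open>1 / q\<close>, of order \<open>ln r / r\<close>, plus the two exceptional counts relative
  to a sphere of size at least \<open>d ^ r\<close>. The constants make both of these exponentially
  small.\<close>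

lemma conjugacy_ratio_bigo:
  assumes "exp_growth phi S"
  shows "(\<lambda>r. real (num_classes phi (min_sphere phi S r)) / real (card (sphere phi S r)))
    \<in> O(\<lambda>r. ln (real r) / real r)"
proof -
  obtain d :: real where d: "d > 1" "\<And>r. d ^ r \<le> real (card (sphere phi S r))"
    using sphere_lower_bound[OF assms] by blast
  obtain a m where comm: "\<And>r D. card (commuting r D) \<le> card (words D) * ((2 * r + 1) * (r * (2 * r + 1) ^ a + 1) ^ m)"
    using card_commuting by blast
  define p where "p = card (insert 0 R)"
  define \<sigma> where "\<sigma> = real (card S)"
  define L where "L = ln d"
  have L: "L > 0" using d(1) by (simp add: L_def)
  have "1 \<le> card S" using finite_gen by (auto simp: Suc_le_eq card_gt_0_iff gen_set_def)
  then have \<sigma>: "\<sigma> \<ge> 1" by (simp add: \<sigma>_def)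
  \<comment> \<open>With this \<open>T\<close>, the number of elements given by words of length at
    most \<open>r div T + 1\<close> is at most \<open>exp (L * r / 2)\<close> up to a polynomial
    factor.\<close>
  define T where "T = nat \<lceil>2 * ln \<sigma> / L\<rceil> + 1"
  have T: "T > 0" "ln \<sigma> / T \<le> L / 2"
  proof -
    have "2 * ln \<sigma> / L \<le> real T" unfolding T_def by linarith
    then show "ln \<sigma> / T \<le> L / 2" using L by (simp add: T_def field_simps)
  qed (simp add: T_def)
  \<comment> \<open>With this constant the exponent in \<open>A r\<close> is asymptotic to
    \<open>L * r / 4\<close>, as \<open>ln (2 * r + 1) / ln r\<close> tends to 1.\<close>
  define \<epsilon> where "\<epsilon> = L / (4 * (p + 1))"
  have \<epsilon>: "\<epsilon> > 0" using L by (simp add: \<epsilon>_def)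
  define x where "x r = \<epsilon> * real r / ln (real r)" for r :: nat
  \<comment> \<open>Rounding down keeps \<open>n r = q r * T\<close> at most \<open>x r\<close>,
    while \<open>q r\<close> still has order \<open>r / ln r\<close>.\<close>
  define q where "q r = nat \<lfloor>x r / T\<rfloor>" for r :: nat
  define n where "n r = q r * T" for r
  define A where "A r = (2 * real r + 1) * exp (x r * ((real p + 1) * ln (2 * real r + 1)))" for r :: nat
  define Z where "Z r = (real r + 2) * (\<sigma> * exp (L / 2 * real r)) * ((2 * real r + 1) * (real r * (2 * real r + 1) ^ a + 1) ^ m)" for r :: nat
  let ?N = "\<lambda>r. real (num_classes phi (min_sphere phi S r))" and ?s = "\<lambda>r. real (card (sphere phi S r))"
  have dr: "d ^ r = exp (L * real r)" for r
    using d(1) by (simp add: L_def exp_of_nat2_mult)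
  have bound: "?N r / ?s r \<le> 1 / real (q r) + (A r + Z r) / exp (L * real r)" if r: "r \<ge> 2" "q r > 0" for r
  proof -
    have x0: "x r \<ge> 0" using r \<epsilon> by (simp add: x_def)
    have nx: "real (n r) \<le> x r"
    proof -
      have "real (q r) \<le> x r / T" unfolding q_def using x0 by simp
      then show ?thesis using T(1) by (simp add: n_def field_simps)
    qed
    have few: "real (card (few_levels r (n r))) \<le> A r"
    proof -
      have "real (card (few_levels r (n r))) \<le> real ((2 * r + 1) * ((2 * r + 1) * (r + 1) ^ p) ^ n r)"
        using few_levels_finite_card(2)[of r "n r"] unfolding p_def by (simp only: of_nat_le_iff)
      also have "\<dots> = (2 * real r + 1) * ((2 * real r + 1) * (real r + 1) ^ p) ^ n r"
        by (simp only: of_nat_mult of_nat_add of_nat_power of_nat_1 of_nat_numeral)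
      also have "\<dots> \<le> (2 * real r + 1) * ((2 * real r + 1) * (2 * real r + 1) ^ p) ^ n r"
        by (intro mult_left_mono power_mono) auto
      also have "((2 * real r + 1) * (2 * real r + 1) ^ p) ^ n r = exp (real (n r) * ((real p + 1) * ln (2 * real r + 1)))"
      proof -
        have "(2 * real r + 1) ^ Suc p = exp ((real p + 1) * ln (2 * real r + 1))"
          using exp_of_nat_mult[of "Suc p" "ln (2 * real r + 1)"] by (simp add: add.commute)
        then show ?thesis by (simp add: exp_of_nat_mult)
      qed
      also have "(2 * real r + 1) * \<dots> \<le> A r"
        unfolding A_def using nx by (intro mult_left_mono) (auto intro!: mult_right_mono)
      finally show ?thesis by simp
    qed
    have com: "real (card (commuting r (r div T + 1))) \<le> Z r"
    proof -
      let ?D = "r div T + 1" and ?P = "(2 * r + 1) * (r * (2 * r + 1) ^ a + 1) ^ m"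
      have "card (commuting r ?D) \<le> (?D + 1) * card S ^ ?D * ?P"
        using comm[of r ?D] card_words[of ?D] by (meson mult_le_mono1 order_trans)
      then have "real (card (commuting r ?D)) \<le> real ((?D + 1) * card S ^ ?D * ?P)"
        by (simp only: of_nat_le_iff)
      also have "\<dots> = (real ?D + 1) * \<sigma> ^ ?D * real ?P"
        by (simp only: of_nat_mult of_nat_add[of ?D 1] of_nat_power of_nat_1 \<sigma>_def)
      also have "\<dots> \<le> (real r + 2) * (\<sigma> * exp (L / 2 * real r)) * real ?P"
      proof (intro mult_right_mono mult_mono)
        show "real ?D + 1 \<le> real r + 2" using div_le_dividend[of r T] by simp
        have "\<sigma> ^ (r div T) = exp (real (r div T) * ln \<sigma>)" using \<sigma> by (simp add: exp_of_nat_mult)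
        also have "\<dots> \<le> exp (L / 2 * real r)"
        proof -
          have "real (r div T) \<le> real r / T" by (rule of_nat_div_le_of_nat)
          then have "real (r div T) * ln \<sigma> \<le> real r / T * ln \<sigma>" using \<sigma> by (intro mult_right_mono) auto
          also have "\<dots> = real r * (ln \<sigma> / T)" by simp
          also have "\<dots> \<le> real r * (L / 2)" using T(2) by (intro mult_left_mono) auto
          finally show ?thesis by (simp add: mult.commute)
        qed
        finally show "\<sigma> ^ ?D \<le> \<sigma> * exp (L / 2 * real r)" using \<sigma> by simp
      qed (use \<sigma> in auto)
      also have "\<dots> = Z r"
        unfolding Z_def by (simp only: of_nat_mult of_nat_add of_nat_power of_nat_1 of_nat_numeral)
      finally show ?thesis .
    qed
    have s: "exp (L * real r) \<le> ?s r" using d(2)[of r] dr by simp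
    then have s0: "?s r > 0" using exp_gt_zero[of "L * real r"] by linarith
    have "real (q r) * ?N r \<le> ?s r + real (q r) * (real (card (few_levels r (n r))) + real (card (commuting r (r div T + 1))))"
      using num_classes_bound[OF T(1) order_refl, of "q r" r] unfolding n_def
      by (simp only: of_nat_le_iff flip: of_nat_mult of_nat_add)
    also have "\<dots> \<le> ?s r + real (q r) * (A r + Z r)" using few com by (intro add_left_mono mult_left_mono) auto
    finally have "?N r \<le> ?s r / real (q r) + (A r + Z r)" using r(2) by (simp add: field_simps)
    then have "?N r / ?s r \<le> (?s r / real (q r) + (A r + Z r)) / ?s r" using s0 by (intro divide_right_mono) auto
    also have "\<dots> = 1 / real (q r) + (A r + Z r) / ?s r" using s0 by (simp add: add_divide_distrib)
    also have "\<dots> \<le> 1 / real (q r) + (A r + Z r) / exp (L * real r)"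
    proof -
      have "0 \<le> A r + Z r" using few com by linarith
      then show ?thesis using s s0 by (intro add_left_mono divide_left_mono) auto
    qed
    finally show ?thesis .
  qed
  have xlim: "filterlim x at_top sequentially"
    unfolding x_def using \<epsilon> by real_asymp
  have evq: "eventually (\<lambda>r. q r > 0 \<and> 1 / real (q r) \<le> 2 * real T / x r) sequentially"
  proof -
    have "eventually (\<lambda>r. x r \<ge> 2 * T) sequentially" using xlim by (simp add: filterlim_at_top)
    then show ?thesis
    proof eventually_elim
      case (elim r)
      define y where "y = x r / T"
      have y: "y \<ge> 2" using elim T(1) by (simp add: y_def field_simps)
      then have "real (q r) \<ge> y / 2" "q r > 0" unfolding q_def y_def[symmetric] by linarith+
      then have "1 / real (q r) \<le> 1 / (y / 2)"
        using y by (intro divide_left_mono) auto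
      with \<open>q r > 0\<close> show ?case by (simp add: y_def mult.commute)
    qed
  qed
  \<comment> \<open>Only this first term has the order of the claimed bound; the other two decay
    exponentially.\<close>
  have 1: "(\<lambda>r. 2 * real T / x r) \<in> O(\<lambda>r. ln (real r) / real r)"
    unfolding x_def using \<epsilon> by real_asymp
  have 2: "(\<lambda>r. A r / exp (L * real r)) \<in> O(\<lambda>r. ln (real r) / real r)"
    unfolding A_def x_def \<epsilon>_def using L by real_asymp
  have 3: "(\<lambda>r. Z r / exp (L * real r)) \<in> O(\<lambda>r. ln (real r) / real r)"
    unfolding Z_def using L \<sigma> by real_asymp
  have "(\<lambda>r. ?N r / ?s r) \<in> O(\<lambda>r. 2 * real T / x r + (A r / exp (L * real r) + Z r / exp (L * real r)))"
  proof (rule landau_o.big_mono)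
    show "eventually (\<lambda>r. norm (?N r / ?s r) \<le> norm (2 * real T / x r + (A r / exp (L * real r) + Z r / exp (L * real r)))) sequentially"
      using evq eventually_ge_at_top[of 2]
    proof eventually_elim
      case (elim r)
      then have "?N r / ?s r \<le> 2 * real T / x r + (A r / exp (L * real r) + Z r / exp (L * real r))"
        using bound[of r] unfolding add_divide_distrib by linarith
      then show ?case using abs_ge_self order_trans by simp
    qed
  qed
  also have "(\<lambda>r. 2 * real T / x r + (A r / exp (L * real r) + Z r / exp (L * real r))) \<in> O(\<lambda>r. ln (real r) / real r)"
    using 1 2 3 by (intro sum_in_bigo)
  finally show ?thesis .
qed

end

theorem theorem4p4:
  fixes phi :: "'k::ab_group_add \<Rightarrow> 'k" and R :: "'k set"
  assumes "bij phi"
    and "\<forall>a b. phi (a + b) = phi a + phi b"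
    and "finite R"
    and "\<forall>r\<in>R. - r \<in> R"
    and "\<forall>g. \<exists>ws. set ws \<subseteq> gen_set R \<and> sd_prod phi ws = g"
    and "exp_growth phi (gen_set R)"
  shows "(\<lambda>r::nat. real (num_classes phi (min_sphere phi (gen_set R) r))
                     / real (card (sphere phi (gen_set R) r)))
         \<in> O(\<lambda>r. ln (real r) / real r)"
proof -
  interpret semidirect phi R
    using assms by unfold_locales auto
  show ?thesis using assms(6) by (rule conjugacy_ratio_bigo)
qed

end
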